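(* For any finite set $X$ define $\Phi:\mathbb{D}_X\to\widetilde{\mathbb{D}}_X\otimes\mathbb{D}_X$ by $$\Phi(\mathcal{T},Y)=\sum_{\mathcal{T}'}(\mathcal{T},\mathcal{T}')\otimes(\mathcal{T}/\mathcal{T}',Y),$$ where the sum runs over all topologies $\mathcal{T}'$ on $X$ such that $\mathcal{T}'\preccurlyeq_{\mathrm{ad}}\mathcal{T}$, $Y\in\mathcal{T}/\mathcal{T}'$, and $\mathcal{T}'_{|X\setminus Y}=D_{X\setminus Y,\mathcal{T}'}$. Then $\mathbb{D}$ admits a comodule structure on $\widetilde{\mathbb{D}}$ given by $\Phi$; that is, for every finite set $X$, $\Phi$ is a left coaction of the coalgebra $(\widetilde{\mathbb{D}}_X,\Gamma)$ on $\mathbb{D}_X$ (in particular $(\mathrm{id}\otimes\Phi)\circ\Phi=(\Gamma\otimes\mathrm{id})\circ\Phi$).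
   Context: $\mathbf{k}$ is a field. A topology on a finite set $X$ is identified with its family $\mathcal{T}$ of open subsets. It corresponds bijectively to a quasi-order: $x\le_{\mathcal{T}}y$ iff every open subset containing $x$ contains $y$ (open subsets are the upper ideals). Put $x\sim_{\mathcal{T}}y$ iff $x\le_{\mathcal{T}}y$ and $y\le_{\mathcal{T}}x$. For $Y\subset X$, $\mathcal{T}_{|Y}=\{Z\cap Y:Z\in\mathcal{T}\}$. For topologies on the same set $X$, $\mathcal{T}'$ is finer than $\mathcal{T}$, written $\mathcal{T}'\prec\mathcal{T}$, if every $\mathcal{T}$-open set is $\mathcal{T}'$-open (equality is allowed). If $\mathcal{T}'\prec\mathcal{T}$, the quotient $\mathcal{T}/\mathcal{T}'$ is the topology on $X$ whose quasi-order is the transitive closure of the relation: $x\le_{\mathcal{T}}y$ or $y\le_{\mathcal{T}'}x$. The topology $\mathcal{T}'$ is $\mathcal{T}$-admissible, written $\mathcal{T}'\preccurlyeq_{\mathrm{ad}}\mathcal{T}$, if: (i) $\mathcal{T}'\prec\mathcal{T}$; (ii) $\mathcal{T}'_{|Y}=\mathcal{T}_{|Y}$ for every $Y\subset X$ connected for $\mathcal{T}'$; (iii) for all $x,y\in X$, $x\sim_{\mathcal{T}/\mathcal{T}'}y\iff x\sim_{\mathcal{T}'/\mathcal{T}'}y$. For a topology $\mathcal{T}$ on $X$, $D_{X,\mathcal{T}}$ denotes the finest $\mathcal{T}$-admissible topology: its connected components are the equivalence classes of $\sim_{\mathcal{T}}$, and its restriction to each of them is the coarse topology. For $Y\subset X$,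 $D_{Y,\mathcal{T}}$ means $D_{Y,\mathcal{T}_{|Y}}$. $\mathbb{D}_X$ is the $\mathbf{k}$-vector space with basis the pairs $(\mathcal{T},Y)$ with $\mathcal{T}$ a topology on $X$ and $Y\in\mathcal{T}$. $\widetilde{\mathbb{D}}_X$ is the $\mathbf{k}$-vector space with basis the pairs $(\mathcal{T},\mathcal{T}')$ of topologies on $X$ with $\mathcal{T}'\preccurlyeq_{\mathrm{ad}}\mathcal{T}$; it is a coalgebra with coproduct $\Gamma(\mathcal{T},\mathcal{T}')=\sum_{\mathcal{T}''\preccurlyeq_{\mathrm{ad}}\mathcal{T}'}(\mathcal{T},\mathcal{T}'')\otimes(\mathcal{T}/\mathcal{T}'',\mathcal{T}'/\mathcal{T}'')$ and counit $\epsilon(\mathcal{T},\mathcal{T}')=1$ if the number of $\sim_{\mathcal{T}'}$-classes equals the number of connected components of $\mathcal{T}'$, and $0$ otherwise. *)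

theory Defs
  imports "HOL-Analysis.Analysis" "HOL-Library.Poly_Mapping"
begin

section \<open>Vector spaces with a given basis\<close>

text \<open>The vector space with basis \<open>B\<close> is the set \<open>free_space B\<close> of finitely supported functions
  with support in \<open>B\<close>; a basis element \<open>b\<close> is the vector \<open>bvec b\<close>. The tensor product of
  \<open>free_space B\<close> and \<open>free_space C\<close> is \<open>free_space (B \<times> C)\<close>, the basis vector at \<open>(b, c)\<close> being
  \<open>bvec b \<otimes> bvec c\<close>.\<close>

definition free_space :: "'b set \<Rightarrow> ('b \<Rightarrow>\<^sub>0 'k::field) set" where
  "free_space B = {v. Poly_Mapping.keys v \<subseteq> B}"

definition bvec :: "'b \<Rightarrow> ('b \<Rightarrow>\<^sub>0 'k::field)" where
  "bvec b = Poly_Mapping.single b 1"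

definition fscale :: "'k::field \<Rightarrow> ('b \<Rightarrow>\<^sub>0 'k) \<Rightarrow> ('b \<Rightarrow>\<^sub>0 'k)" where
  "fscale c v = Poly_Mapping.map ((*) c) v"

definition tensor :: "('b \<Rightarrow>\<^sub>0 'k::field) \<Rightarrow> ('c \<Rightarrow>\<^sub>0 'k) \<Rightarrow> ('b \<times> 'c \<Rightarrow>\<^sub>0 'k)" (infixr \<open>\<otimes>\<close> 70) where
  "u \<otimes> v = (\<Sum>b\<in>Poly_Mapping.keys u. \<Sum>c\<in>Poly_Mapping.keys v.
     Poly_Mapping.single (b, c) (Poly_Mapping.lookup u b * Poly_Mapping.lookup v c))"

text \<open>Linear extension of \<open>f\<close> from basis elements; \<open>s\<close> is the scalar multiplication of the target
  (\<open>fscale\<close>, or multiplication of the field when the target is the field).\<close>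

definition lin_ext :: "('k::field \<Rightarrow> 'v \<Rightarrow> 'v) \<Rightarrow> ('b \<Rightarrow> 'v) \<Rightarrow> ('b \<Rightarrow>\<^sub>0 'k) \<Rightarrow> 'v::comm_monoid_add" where
  "lin_ext s f v = (\<Sum>b\<in>Poly_Mapping.keys v. s (Poly_Mapping.lookup v b) (f b))"

definition linear_between ::
    "('k \<Rightarrow> 'v \<Rightarrow> 'v) \<Rightarrow> ('k \<Rightarrow> 'w \<Rightarrow> 'w) \<Rightarrow> 'v set \<Rightarrow> 'w set \<Rightarrow> ('v::plus \<Rightarrow> 'w::plus) \<Rightarrow> bool" where
  "linear_between s t V W f \<longleftrightarrow> f ` V \<subseteq> W \<and>
     (\<forall>u\<in>V. \<forall>v\<in>V. f (u + v) = f u + f v) \<and> (\<forall>c. \<forall>v\<in>V. f (s c v) = t c (f v))"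

text \<open>For linear \<open>f\<close> and \<open>g\<close>, \<open>tensor_map f g\<close> is their tensor product; \<open>counit_left \<epsilon>\<close> and
  \<open>counit_right \<epsilon>\<close> are the tensor products of \<open>\<epsilon>\<close> with the identity, followed by the identification
  of the tensor product of the field and \<open>V\<close> with \<open>V\<close>.\<close>

definition tensor_map ::
    "(('b \<Rightarrow>\<^sub>0 'k::field) \<Rightarrow> ('d \<Rightarrow>\<^sub>0 'k)) \<Rightarrow> (('c \<Rightarrow>\<^sub>0 'k) \<Rightarrow> ('e \<Rightarrow>\<^sub>0 'k)) \<Rightarrow>
     ('b \<times> 'c \<Rightarrow>\<^sub>0 'k) \<Rightarrow> ('d \<times> 'e \<Rightarrow>\<^sub>0 'k)" where
  "tensor_map f g = lin_ext fscale (\<lambda>(b, c). f (bvec b) \<otimes> g (bvec c))"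

definition tensor_assoc :: "(('b \<times> 'c) \<times> 'd \<Rightarrow>\<^sub>0 'k::field) \<Rightarrow> ('b \<times> 'c \<times> 'd \<Rightarrow>\<^sub>0 'k)" where
  "tensor_assoc = lin_ext fscale (\<lambda>((b, c), d). bvec b \<otimes> bvec c \<otimes> bvec d)"

definition counit_left :: "(('b \<Rightarrow>\<^sub>0 'k::field) \<Rightarrow> 'k) \<Rightarrow> ('b \<times> 'c \<Rightarrow>\<^sub>0 'k) \<Rightarrow> ('c \<Rightarrow>\<^sub>0 'k)" where
  "counit_left \<epsilon> = lin_ext fscale (\<lambda>(b, c). fscale (\<epsilon> (bvec b)) (bvec c))"

definition counit_right :: "(('c \<Rightarrow>\<^sub>0 'k::field) \<Rightarrow> 'k) \<Rightarrow> ('b \<times> 'c \<Rightarrow>\<^sub>0 'k) \<Rightarrow> ('b \<Rightarrow>\<^sub>0 'k)" where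
  "counit_right \<epsilon> = lin_ext fscale (\<lambda>(b, c). fscale (\<epsilon> (bvec c)) (bvec b))"

definition coalgebra ::
    "'b set \<Rightarrow> (('b \<Rightarrow>\<^sub>0 'k::field) \<Rightarrow> ('b \<times> 'b \<Rightarrow>\<^sub>0 'k)) \<Rightarrow> (('b \<Rightarrow>\<^sub>0 'k) \<Rightarrow> 'k) \<Rightarrow> bool" where
  "coalgebra B \<Delta> \<epsilon> \<longleftrightarrow>
     linear_between fscale fscale (free_space B) (free_space (B \<times> B)) \<Delta> \<and>
     linear_between fscale (*) (free_space B) UNIV \<epsilon> \<and>
     (\<forall>v\<in>free_space B. tensor_map id \<Delta> (\<Delta> v) = tensor_assoc (tensor_map \<Delta> id (\<Delta> v))) \<and>
     (\<forall>v\<in>free_space B. counit_left \<epsilon> (\<Delta> v) = v \<and> counit_right \<epsilon> (\<Delta> v) = v)"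

definition left_comodule ::
    "'b set \<Rightarrow> (('b \<Rightarrow>\<^sub>0 'k::field) \<Rightarrow> ('b \<times> 'b \<Rightarrow>\<^sub>0 'k)) \<Rightarrow> (('b \<Rightarrow>\<^sub>0 'k) \<Rightarrow> 'k) \<Rightarrow>
     'c set \<Rightarrow> (('c \<Rightarrow>\<^sub>0 'k) \<Rightarrow> ('b \<times> 'c \<Rightarrow>\<^sub>0 'k)) \<Rightarrow> bool" where
  "left_comodule B \<Delta> \<epsilon> C \<rho> \<longleftrightarrow>
     coalgebra B \<Delta> \<epsilon> \<and>
     linear_between fscale fscale (free_space C) (free_space (B \<times> C)) \<rho> \<and>
     (\<forall>v\<in>free_space C. tensor_map id \<rho> (\<rho> v) = tensor_assoc (tensor_map \<Delta> id (\<rho> v))) \<and>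
     (\<forall>v\<in>free_space C. counit_left \<epsilon> (\<rho> v) = v)"

lemma tensor_bvec: "bvec b \<otimes> bvec c = (bvec (b, c) :: 'b \<times> 'c \<Rightarrow>\<^sub>0 'k::field)"
  by (simp add: tensor_def bvec_def)

lemma vector_space_fscale: "vector_space (fscale :: 'k::field \<Rightarrow> ('b \<Rightarrow>\<^sub>0 'k) \<Rightarrow> _)"
  by unfold_locales
    (auto simp: fscale_def poly_mapping_eq_iff fun_eq_iff map.rep_eq lookup_add when_def
      simp flip: distrib_left distrib_right)


section \<open>Topologies and quasi-orders\<close>

definition top_le :: "'a topology \<Rightarrow> ('a \<times> 'a) set" where
  "top_le T = {(x, y). x \<in> topspace T \<and> y \<in> topspace T \<and> (\<forall>U. openin T U \<and> x \<in> U \<longrightarrow> y \<in> U)}"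

definition top_sim :: "'a topology \<Rightarrow> ('a \<times> 'a) set" where
  "top_sim T = top_le T \<inter> (top_le T)\<inverse>"

definition upper_topology :: "'a set \<Rightarrow> ('a \<times> 'a) set \<Rightarrow> 'a topology" where
  "upper_topology X R = topology (\<lambda>U. U \<subseteq> X \<and> (\<forall>x\<in>U. \<forall>y\<in>X. (x, y) \<in> R \<longrightarrow> y \<in> U))"

definition finer :: "'a topology \<Rightarrow> 'a topology \<Rightarrow> bool" where
  "finer T' T \<longleftrightarrow> topspace T' = topspace T \<and> (\<forall>U. openin T U \<longrightarrow> openin T' U)"

text \<open>The quotient is the topology whose quasi-order is the given transitive closure
  (see \<open>top_le_top_quot\<close> below); its open sets are the upper ideals.\<close>

definition top_quot :: "'a topology \<Rightarrow> 'a topology \<Rightarrow> 'a topology" where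
  "top_quot T T' = upper_topology (topspace T) ((top_le T \<union> (top_le T')\<inverse>)\<^sup>+)"

definition admissible :: "'a topology \<Rightarrow> 'a topology \<Rightarrow> bool" where
  "admissible T' T \<longleftrightarrow> finer T' T \<and>
     (\<forall>Y. connectedin T' Y \<longrightarrow> subtopology T' Y = subtopology T Y) \<and>
     (\<forall>x\<in>topspace T. \<forall>y\<in>topspace T.
        (x, y) \<in> top_sim (top_quot T T') \<longleftrightarrow> (x, y) \<in> top_sim (top_quot T' T'))"

text \<open>Existence, and the description by the classes of \<open>top_sim T\<close>, are proved in
  \<open>finest_admissible_eq\<close>. For a subset \<open>Y\<close>, the topology \<open>D\<close> of \<open>Y\<close> and \<open>T\<close> is
  \<open>finest_admissible (subtopology T Y)\<close>.\<close>

definition finest_admissible :: "'a topology \<Rightarrow> 'a topology" where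
  "finest_admissible T = (THE D. admissible D T \<and> (\<forall>T'. admissible T' T \<longrightarrow> finer D T'))"


section \<open>The coalgebra and the coaction\<close>

definition D_basis :: "'a set \<Rightarrow> ('a topology \<times> 'a set) set" where
  "D_basis X = {(T, Y). topspace T = X \<and> openin T Y}"

definition Dt_basis :: "'a set \<Rightarrow> ('a topology \<times> 'a topology) set" where
  "Dt_basis X = {(T, T'). topspace T = X \<and> topspace T' = X \<and> admissible T' T}"

definition Gamma_cop :: "('a topology \<times> 'a topology \<Rightarrow>\<^sub>0 'k::field) \<Rightarrow>
    (('a topology \<times> 'a topology) \<times> ('a topology \<times> 'a topology) \<Rightarrow>\<^sub>0 'k)" where
  "Gamma_cop = lin_ext fscale (\<lambda>(T, T').
     \<Sum>T'' | admissible T'' T'. bvec (T, T'') \<otimes> bvec (top_quot T T'', top_quot T' T''))"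

definition counit :: "('a topology \<times> 'a topology \<Rightarrow>\<^sub>0 'k::field) \<Rightarrow> 'k" where
  "counit = lin_ext (*) (\<lambda>(T, T').
     if card (topspace T' // top_sim T') = card (connected_components_of T') then 1 else 0)"

definition Phi :: "('a topology \<times> 'a set \<Rightarrow>\<^sub>0 'k::field) \<Rightarrow>
    (('a topology \<times> 'a topology) \<times> ('a topology \<times> 'a set) \<Rightarrow>\<^sub>0 'k)" where
  "Phi = lin_ext fscale (\<lambda>(T, Y).
     \<Sum>T' | admissible T' T \<and> openin (top_quot T T') Y \<and>
            subtopology T' (topspace T - Y) = finest_admissible (subtopology T' (topspace T - Y)).
       bvec (T, T') \<otimes> bvec (top_quot T T', Y))"


section \<open>Agreement with the quasi-order description\<close>

lemma openin_upper_topology: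
  "openin (upper_topology X R) U \<longleftrightarrow> U \<subseteq> X \<and> (\<forall>x\<in>U. \<forall>y\<in>X. (x, y) \<in> R \<longrightarrow> y \<in> U)"
proof -
  have "istopology (\<lambda>U. U \<subseteq> X \<and> (\<forall>x\<in>U. \<forall>y\<in>X. (x, y) \<in> R \<longrightarrow> y \<in> U))"
    unfolding istopology_def by blast
  then show ?thesis
    by (simp add: upper_topology_def topology_inverse')
qed

lemma topspace_upper_topology [simp]: "topspace (upper_topology X R) = X"
  by (auto simp: topspace_def openin_upper_topology)

lemma topspace_top_quot [simp]: "topspace (top_quot T T') = topspace T"
  by (simp add: top_quot_def)

lemma top_le_subset: "top_le T \<subseteq> topspace T \<times> topspace T"
  by (auto simp: top_le_def)

lemma top_le_refl: "x \<in> topspace T \<Longrightarrow> (x, x) \<in> top_le T"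
  by (auto simp: top_le_def)

lemma trans_top_le: "trans (top_le T)"
  by (auto simp: top_le_def trans_def)

lemma top_le_upper_topology:
  assumes "R \<subseteq> X \<times> X" "\<And>x. x \<in> X \<Longrightarrow> (x, x) \<in> R" "trans R"
  shows "top_le (upper_topology X R) = R"
proof -
  have "(x, y) \<in> R" if xy: "(x, y) \<in> top_le (upper_topology X R)" for x y
  proof -
    have "openin (upper_topology X R) (R `` {x})"
      unfolding openin_upper_topology using assms(1,3) by (auto dest: transD)
    moreover have "x \<in> R `` {x}"
      using xy assms(2) by (auto simp: top_le_def)
    ultimately show ?thesis
      using xy by (auto simp: top_le_def)
  qed
  moreover have "(x, y) \<in> top_le (upper_topology X R)" if "(x, y) \<in> R" for x y
    using that assms(1) by (auto simp: top_le_def openin_upper_topology)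
  ultimately show ?thesis by auto
qed

lemma upper_topology_top_le:
  assumes "finite (topspace T)"
  shows "upper_topology (topspace T) (top_le T) = T"
proof (rule topology_eq[THEN iffD2], intro allI iffI)
  fix U
  assume U: "openin (upper_topology (topspace T) (top_le T)) U"
  show "openin T U"
  proof (subst openin_subopen, intro ballI)
    fix x assume x: "x \<in> U"
    define M where "M = \<Inter>{V. openin T V \<and> x \<in> V}"
    have xT: "x \<in> topspace T"
      using U x by (auto simp: openin_upper_topology)
    have "finite {V. openin T V \<and> x \<in> V}"
      by (rule finite_subset[of _ "Pow (topspace T)"]) (use assms openin_subset in auto)
    then have "openin T M"
      unfolding M_def using xT by (intro openin_Inter) auto
    moreover have "M \<subseteq> U"
    proof
      fix y assume y: "y \<in> M"
      then have "y \<in> topspace T" using xT by (auto simp: M_def)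
      with y xT have "(x, y) \<in> top_le T" by (auto simp: top_le_def M_def)
      with U x \<open>y \<in> topspace T\<close> show "y \<in> U" by (auto simp: openin_upper_topology)
    qed
    ultimately show "\<exists>V. openin T V \<and> x \<in> V \<and> V \<subseteq> U"
      by (intro exI[of _ M]) (auto simp: M_def)
  qed
next
  fix U assume "openin T U"
  then show "openin (upper_topology (topspace T) (top_le T)) U"
    by (auto simp: openin_upper_topology top_le_def dest: openin_subset)
qed

lemma top_le_top_quot:
  assumes "topspace T' = topspace T"
  shows "top_le (top_quot T T') = (top_le T \<union> (top_le T')\<inverse>)\<^sup>+"
  unfolding top_quot_def
proof (rule top_le_upper_topology)
  have "top_le T \<union> (top_le T')\<inverse> \<subseteq> topspace T \<times> topspace T"
    using top_le_subset[of T] top_le_subset[of T'] assms by auto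
  then show "(top_le T \<union> (top_le T')\<inverse>)\<^sup>+ \<subseteq> topspace T \<times> topspace T"
    by (rule trancl_subset_Sigma)
qed (auto intro: top_le_refl)

lemma equiv_top_sim: "equiv (topspace T) (top_sim T)"
proof (rule equivI)
  show "top_sim T \<subseteq> topspace T \<times> topspace T"
    using top_le_subset[of T] by (auto simp: top_sim_def)
  show "refl_on (topspace T) (top_sim T)"
    by (auto simp: refl_on_def top_sim_def intro: top_le_refl)
  show "sym (top_sim T)"
    by (auto simp: sym_def top_sim_def)
  show "trans (top_sim T)"
    unfolding top_sim_def by (intro trans_Int trans_top_le) (simp add: trans_top_le)
qed

lemma top_le_subtopology:
  "x \<in> Y \<Longrightarrow> y \<in> Y \<Longrightarrow> (x, y) \<in> top_le (subtopology T Y) \<longleftrightarrow> (x, y) \<in> top_le T"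
  by (auto simp: top_le_def openin_subtopology)

lemma connected_component_of_top_le:
  assumes "(x, y) \<in> top_le T"
  shows "connected_component_of T x y"
proof -
  have "connectedin T {x, y}"
    using assms unfolding connectedin top_le_def by blast
  then show ?thesis
    by (auto simp: connected_component_of_def)
qed

lemma top_sim_admissible:
  assumes "admissible T' T" "(x, y) \<in> top_sim T"
  shows "(x, y) \<in> top_sim T'"
proof -
  have sp: "topspace T' = topspace T"
    using assms(1) by (auto simp: admissible_def finer_def)
  have x: "x \<in> topspace T" and y: "y \<in> topspace T"
    using assms(2) by (auto simp: top_sim_def top_le_def)
  have "(x, y) \<in> (top_le T \<union> (top_le T')\<inverse>)\<^sup>+" "(y, x) \<in> (top_le T \<union> (top_le T')\<inverse>)\<^sup>+"
    using assms(2) by (auto simp: top_sim_def)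
  then have "(x, y) \<in> top_sim (top_quot T T')"
    by (simp add: top_sim_def top_le_top_quot[OF sp])
  then have "(x, y) \<in> top_sim (top_quot T' T')"
    using assms(1) x y unfolding admissible_def by blast
  then have "(x, y) \<in> (top_le T' \<union> (top_le T')\<inverse>)\<^sup>+"
    by (simp add: top_sim_def top_le_top_quot)
  then have c: "connected_component_of T' x y"
  proof (induction rule: trancl_induct)
    case (base y)
    then show ?case
      using connected_component_of_top_le connected_component_of_sym by fastforce
  next
    case (step y z)
    then have "connected_component_of T' y z"
      using connected_component_of_top_le connected_component_of_sym by fastforce
    with step.IH show ?case
      by (rule connected_component_of_trans)
  qed
  then obtain Y where Y: "connectedin T' Y" "x \<in> Y" "y \<in> Y"
    by (auto simp: connected_component_of_def)
  then have "subtopology T' Y = subtopology T Y"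
    using assms(1) by (auto simp: admissible_def)
  then show ?thesis
    using assms(2) Y(2,3) top_le_subtopology unfolding top_sim_def
    by (metis Int_iff converse_iff)
qed

lemma finest_admissible_eq:
  "finest_admissible T = upper_topology (topspace T) (top_sim T)" (is "_ = ?D")
  and admissible_finest_admissible: "admissible (finest_admissible T) T"
  and finer_finest_admissible: "admissible T' T \<Longrightarrow> finer (finest_admissible T) T'"
proof -
  have S: "top_sim T \<subseteq> topspace T \<times> topspace T"
    "\<And>x y. (x, y) \<in> top_sim T \<Longrightarrow> (y, x) \<in> top_sim T"
    "\<And>x y z. (x, y) \<in> top_sim T \<Longrightarrow> (y, z) \<in> top_sim T \<Longrightarrow> (x, z) \<in> top_sim T"
    "\<And>x. x \<in> topspace T \<Longrightarrow> (x, x) \<in> top_sim T"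
    using equiv_top_sim[of T] unfolding equiv_def refl_on_def sym_def trans_def by blast+
  have leD: "top_le ?D = top_sim T"
    by (rule top_le_upper_topology[OF S(1) S(4) transI[OF S(3)]])
  have sub: "(x, y) \<in> top_sim T" if Y: "connectedin ?D Y" "x \<in> Y" "y \<in> Y" for x y Y
  proof -
    let ?C = "top_sim T `` {x}"
    have "openin ?D ?C" "openin ?D (topspace T - ?C)"
      unfolding openin_upper_topology using S by blast+
    moreover have YT: "Y \<subseteq> topspace T"
      using connectedin_subset_topspace[OF Y(1)] by simp
    moreover have "x \<in> ?C"
      using Y(2) YT S(4) by blast
    ultimately have "Y \<inter> (topspace T - ?C) = {}"
      using Y(1,2) unfolding connectedin by blast
    then show ?thesis
      using Y(3) YT by blast
  qed
  have adm: "admissible ?D T"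
    unfolding admissible_def
  proof (intro conjI allI impI ballI)
    show "finer ?D T"
      by (auto simp: finer_def openin_upper_topology top_sim_def top_le_def dest: openin_subset)
  next
    fix Y assume Y: "connectedin ?D Y"
    have YT: "Y \<subseteq> topspace T"
      using connectedin_subset_topspace[OF Y] by simp
    have *: "openin (subtopology S Y) Z \<longleftrightarrow> Z = {} \<or> Z = Y"
      if S: "topspace S = topspace T" "top_sim T \<subseteq> top_le S" for S Z
    proof
      assume "openin (subtopology S Y) Z"
      then obtain U where U: "openin S U" "Z = U \<inter> Y"
        by (auto simp: openin_subtopology)
      then show "Z = {} \<or> Z = Y"
        using sub[OF Y] S(2) unfolding top_le_def by blast
    next
      assume "Z = {} \<or> Z = Y"
      then show "openin (subtopology S Y) Z"
        using YT S by (auto simp: openin_subtopology intro: exI[of _ "topspace S"])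
    qed
    show "subtopology ?D Y = subtopology T Y"
      unfolding topology_eq using *[of ?D] *[of T] leD by (auto simp: top_sim_def)
  next
    fix x y
    have "top_le T \<union> (top_le ?D)\<inverse> = top_le T"
      unfolding leD by (auto simp: top_sim_def)
    then have 1: "top_le (top_quot T ?D) = top_le T"
      by (simp add: top_le_top_quot trans_top_le trancl_id)
    have "top_le ?D \<union> (top_le ?D)\<inverse> = top_sim T"
      unfolding leD by (auto simp: top_sim_def)
    then have 2: "top_le (top_quot ?D ?D) = top_sim T"
      using trans_top_le[of ?D] by (simp add: top_le_top_quot leD trancl_id)
    show "(x, y) \<in> top_sim (top_quot T ?D) \<longleftrightarrow> (x, y) \<in> top_sim (top_quot ?D ?D)"
      by (auto simp: top_sim_def[of "top_quot _ _"] 1 2) (auto simp: top_sim_def)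
  qed
  have fin: "finer ?D T'" if T': "admissible T' T" for T'
    unfolding finer_def
  proof (intro conjI allI impI)
    show sp: "topspace ?D = topspace T'"
      using T' by (simp add: admissible_def finer_def)
    fix U assume U: "openin T' U"
    have "y \<in> U" if "x \<in> U" "(x, y) \<in> top_sim T" for x y
      using top_sim_admissible[OF T' that(2)] that(1) U
      unfolding top_sim_def[of T'] top_le_def[of T'] by blast
    then show "openin ?D U"
      using openin_subset[OF U] sp unfolding openin_upper_topology by auto
  qed
  show *: "finest_admissible T = ?D"
    unfolding finest_admissible_def
  proof (rule the_equality)
    fix D assume "admissible D T \<and> (\<forall>T'. admissible T' T \<longrightarrow> finer D T')"
    then have "finer D ?D" "finer ?D D"
      using adm fin by auto
    then show "D = ?D"
      by (auto simp: topology_eq finer_def)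
  qed (use adm fin in auto)
  show "admissible (finest_admissible T) T"
    unfolding * by (rule adm)
  show "finer (finest_admissible T) T'" if "admissible T' T"
    unfolding * using fin[OF that] .
qed

end

theory Submission
  imports Defs
begin

text \<open>A topology on a finite set is its quasi-order \<open>R\<close>. An admissible refinement \<open>V\<close> of \<open>R\<close> is
  determined by its components, being the intersection of \<open>R\<close> with them, and these components are
  the classes of the quotient \<open>R/V\<close>. A path of a quotient with both ends in one component of \<open>V\<close>
  therefore closes up to a cycle of \<open>R/V\<close> and never leaves that component. Consequently, for fixed
  admissible \<open>U\<close>, the map sending \<open>V\<close> to \<open>V/U\<close> is a bijection from the admissible refinements \<open>V\<close>
  of \<open>R\<close> admitting \<open>U\<close> onto the admissible refinements of \<open>R/U\<close>, with \<open>(R/U)/(V/U) = R/V\<close>. It is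
  compatible with the condition defining the coaction, because an open set of \<open>R/V\<close> is a union of
  components of \<open>V\<close>; this gives coassociativity. The counit selects the symmetric refinements: the
  only one of \<open>R\<close> is the finest, and \<open>R/V\<close> is symmetric only for \<open>V = R\<close>.\<close>

section \<open>Linear extension\<close>

lemma lookup_fscale [simp]: "Poly_Mapping.lookup (fscale c v) b = c * Poly_Mapping.lookup v b"
  by (simp add: fscale_def Poly_Mapping.map.rep_eq when_def)

lemma fscale_one [simp]: "fscale 1 v = v"
  by (rule poly_mapping_eqI) simp

lemma fscale_zero_left [simp]: "fscale 0 v = 0"
  by (rule poly_mapping_eqI) simp

lemma single_eq_fscale: "Poly_Mapping.single b c = fscale c (bvec b)"
  by (rule poly_mapping_eqI) (simp add: bvec_def lookup_single when_def)

lemma keys_bvec [simp]: "Poly_Mapping.keys (bvec b :: 'b \<Rightarrow>\<^sub>0 'k::field) = {b}"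
  by (simp add: bvec_def)

lemma lookup_bvec_same [simp]: "Poly_Mapping.lookup (bvec b) b = (1::'k::field)"
  by (simp add: bvec_def)

lemma vec_eq_sum_bvec: "v = (\<Sum>b\<in>Poly_Mapping.keys v. fscale (Poly_Mapping.lookup v b) (bvec b))"
proof (rule poly_mapping_eqI)
  fix k
  have "Poly_Mapping.lookup (\<Sum>b\<in>Poly_Mapping.keys v. fscale (Poly_Mapping.lookup v b) (bvec b)) k =
      (\<Sum>b\<in>Poly_Mapping.keys v. if b = k then Poly_Mapping.lookup v b else 0)"
    unfolding lookup_sum
    by (intro sum.cong) (simp_all add: bvec_def lookup_single when_def)
  also have "\<dots> = Poly_Mapping.lookup v k"
    by (simp add: in_keys_iff)
  finally show "Poly_Mapping.lookup v k =
      Poly_Mapping.lookup (\<Sum>b\<in>Poly_Mapping.keys v. fscale (Poly_Mapping.lookup v b) (bvec b)) k" ..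
qed

lemma vector_space_mult: "vector_space ((*) :: 'k::field \<Rightarrow> 'k \<Rightarrow> 'k)"
  by unfold_locales (auto simp: algebra_simps)

text \<open>Coefficients off the support are zero. Additivity needs a common index set, because
  cancellation can make the support of a sum smaller than the union of the two supports.\<close>

lemma lin_ext_superset:
  assumes "vector_space s" "finite A" "Poly_Mapping.keys v \<subseteq> A"
  shows "lin_ext s f v = (\<Sum>b\<in>A. s (Poly_Mapping.lookup v b) (f b))"
proof -
  interpret vector_space s by fact
  show ?thesis
    unfolding lin_ext_def using assms(2,3)
    by (intro sum.mono_neutral_left) (auto simp: in_keys_iff)
qed

lemma linear_lin_ext:
  fixes s :: "'k::field \<Rightarrow> 'v::ab_group_add \<Rightarrow> 'v"
  assumes "vector_space s"
  shows "Vector_Spaces.linear fscale s (lin_ext s (f :: 'b \<Rightarrow> 'v))"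
proof -
  interpret vector_space s by fact
  interpret fs: vector_space "fscale :: 'k \<Rightarrow> ('b \<Rightarrow>\<^sub>0 'k) \<Rightarrow> _"
    by (rule vector_space_fscale)
  show ?thesis
  proof unfold_locales
    fix u v :: "'b \<Rightarrow>\<^sub>0 'k"
    let ?A = "Poly_Mapping.keys u \<union> Poly_Mapping.keys v"
    have "lin_ext s f w = (\<Sum>b\<in>?A. s (Poly_Mapping.lookup w b) (f b))"
      if "Poly_Mapping.keys w \<subseteq> ?A" for w
      using lin_ext_superset[OF assms _ that] by simp
    from this[of u] this[of v] this[of "u + v"]
    show "lin_ext s f (u + v) = lin_ext s f u + lin_ext s f v"
      using Poly_Mapping.keys_add[of u v]
      by (simp add: lookup_add scale_left_distrib sum.distrib)
  next
    fix c and v :: "'b \<Rightarrow>\<^sub>0 'k"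
    have "lin_ext s f (fscale c v) = (\<Sum>b\<in>Poly_Mapping.keys v. s (Poly_Mapping.lookup (fscale c v) b) (f b))"
      by (rule lin_ext_superset[OF assms]) (auto simp: in_keys_iff)
    then show "lin_ext s f (fscale c v) = s c (lin_ext s f v)"
      by (simp add: lin_ext_def scale_sum_right)
  qed
qed

lemmas linear_lin_ext_fscale = linear_lin_ext[OF vector_space_fscale]

lemma lin_ext_bvec:
  assumes "vector_space s"
  shows "lin_ext s f (bvec b) = f b"
proof -
  interpret vector_space s by fact
  show ?thesis by (simp add: lin_ext_def)
qed

lemmas lin_ext_fscale_bvec [simp] = lin_ext_bvec[OF vector_space_fscale]

lemma lin_ext_sum: "lin_ext fscale f (\<Sum>i\<in>I. v i) = (\<Sum>i\<in>I. lin_ext fscale f (v i))"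
  by (rule module_hom.sum[OF linear_lin_ext_fscale[unfolded linear_iff_module_hom]])

lemma linear_between_lin_ext:
  assumes "vector_space s" "lin_ext s f ` V \<subseteq> W"
  shows "linear_between fscale s V W (lin_ext s f)"
proof -
  interpret Vector_Spaces.linear fscale s "lin_ext s f"
    by (rule linear_lin_ext[OF assms(1)])
  show ?thesis
    using assms(2) by (simp add: linear_between_def add scale)
qed

text \<open>Coassociativity and the counit laws all equate two linear maps, so this reduces each of
  them to basis vectors.\<close>

lemma linear_eq_on_free_space:
  assumes "Vector_Spaces.linear fscale s F" "Vector_Spaces.linear fscale s G"
    and "\<And>b. b \<in> B \<Longrightarrow> F (bvec b) = G (bvec b)" and v: "v \<in> free_space B"
  shows "F v = G v"
proof -
  interpret F: Vector_Spaces.linear fscale s F by fact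
  interpret G: Vector_Spaces.linear fscale s G by fact
  have "F v = (\<Sum>b\<in>Poly_Mapping.keys v. s (Poly_Mapping.lookup v b) (F (bvec b)))"
    by (subst vec_eq_sum_bvec[of v]) (simp add: F.sum F.scale)
  also have "\<dots> = (\<Sum>b\<in>Poly_Mapping.keys v. s (Poly_Mapping.lookup v b) (G (bvec b)))"
    using v assms(3) by (intro sum.cong) (auto simp: free_space_def)
  \<comment> \<open>The third occurrence of \<open>v\<close> is the argument of \<open>G\<close>;
    the first two are the support and the coefficients, which must stay as they are.\<close>
  also have "\<dots> = G v"
    by (subst (3) vec_eq_sum_bvec[of v]) (simp add: G.sum G.scale)
  finally show ?thesis .
qed

section \<open>Membership in free spaces and tensors with a basis vector\<close>

lemma bvec_in_free_space [simp]: "(bvec b :: 'b \<Rightarrow>\<^sub>0 'k::field) \<in> free_space B \<longleftrightarrow> b \<in> B"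
  by (simp add: free_space_def)

lemma sum_in_free_space:
  assumes "\<And>i. i \<in> I \<Longrightarrow> v i \<in> free_space B"
  shows "(\<Sum>i\<in>I. v i) \<in> free_space B"
  using assms Poly_Mapping.keys_sum[of v I] unfolding free_space_def by blast

lemma fscale_in_free_space: "v \<in> free_space B \<Longrightarrow> fscale c v \<in> free_space B"
  by (auto simp: free_space_def in_keys_iff)

lemma lin_ext_in_free_space:
  assumes "v \<in> free_space B" "\<And>b. b \<in> B \<Longrightarrow> f b \<in> free_space C"
  shows "lin_ext fscale f v \<in> free_space C"
  unfolding lin_ext_def using assms
  by (intro sum_in_free_space fscale_in_free_space) (auto simp: free_space_def)

lemma tensor_bvec_left: "bvec b \<otimes> v = lin_ext fscale (\<lambda>c. bvec (b, c)) v"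
  by (simp add: tensor_def lin_ext_def single_eq_fscale)

lemma tensor_bvec_right: "u \<otimes> bvec c = lin_ext fscale (\<lambda>b. bvec (b, c)) u"
  by (simp add: tensor_def lin_ext_def single_eq_fscale)

lemma tensor_assoc_bvec [simp]:
  "tensor_assoc (bvec ((b, c), d)) = (bvec (b, c, d) :: _ \<Rightarrow>\<^sub>0 'k::field)"
  by (simp add: tensor_assoc_def tensor_bvec)

lemma tensor_assoc_sum: "tensor_assoc (\<Sum>i\<in>I. v i) = (\<Sum>i\<in>I. tensor_assoc (v i))"
  by (simp add: tensor_assoc_def lin_ext_sum)

lemma tensor_map_sum: "tensor_map f g (\<Sum>i\<in>I. v i) = (\<Sum>i\<in>I. tensor_map f g (v i))"
  by (simp add: tensor_map_def lin_ext_sum)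

lemma tensor_map_id_bvec: "tensor_map id f (bvec (b, c)) = bvec b \<otimes> f (bvec c)"
  by (simp add: tensor_map_def)

lemma tensor_map_bvec_id: "tensor_map f id (bvec (b, c)) = f (bvec b) \<otimes> bvec c"
  by (simp add: tensor_map_def)

lemma bvec_tensor_sum: "bvec b \<otimes> (\<Sum>i\<in>I. bvec (p i)) = (\<Sum>i\<in>I. bvec (b, p i))"
  by (simp add: tensor_bvec_left lin_ext_sum)

lemma sum_tensor_bvec: "(\<Sum>i\<in>I. bvec (q i)) \<otimes> bvec c = (\<Sum>i\<in>I. bvec (q i, c))"
  by (simp add: tensor_bvec_right lin_ext_sum)

lemma counit_left_sum_bvec:
  "counit_left \<epsilon> (\<Sum>i\<in>I. bvec (p i, q i)) = (\<Sum>i\<in>I. fscale (\<epsilon> (bvec (p i))) (bvec (q i)))"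
  by (simp add: counit_left_def lin_ext_sum)

lemma counit_right_sum_bvec:
  "counit_right \<epsilon> (\<Sum>i\<in>I. bvec (p i, q i)) = (\<Sum>i\<in>I. fscale (\<epsilon> (bvec (q i))) (bvec (p i)))"
  by (simp add: counit_right_def lin_ext_sum)


section \<open>Admissibility for quasi-orders\<close>

text \<open>For the quasi-order of a finite topology, this is the relation of lying in one connected
  component; reflexivity on the carrier is inherited from \<open>R\<close>.\<close>

definition conn :: "('a \<times> 'a) set \<Rightarrow> ('a \<times> 'a) set" where
  "conn R = (R \<union> R\<inverse>)\<^sup>+"

text \<open>The quasi-order of the quotient topology, with the carrier left implicit.\<close>

definition quo :: "('a \<times> 'a) set \<Rightarrow> ('a \<times> 'a) set \<Rightarrow> ('a \<times> 'a) set" where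
  "quo R R' = (R \<union> R'\<inverse>)\<^sup>+"

text \<open>Conditions (i) to (iii) of admissibility in this order. For (ii) and (iii) only one
  inclusion is recorded, the opposite one following from \<open>R' \<subseteq> R\<close>.\<close>

definition adm :: "('a \<times> 'a) set \<Rightarrow> ('a \<times> 'a) set \<Rightarrow> bool" where
  "adm R' R \<longleftrightarrow> R' \<subseteq> R \<and> R \<inter> conn R' \<subseteq> R' \<and> quo R R' \<inter> (quo R R')\<inverse> \<subseteq> conn R'"

lemma trancl_least: "P \<subseteq> W \<Longrightarrow> trans W \<Longrightarrow> P\<^sup>+ \<subseteq> W"
  using trancl_mono_subset[of P W] trancl_id[of W] by simp

lemma conn_converse [simp]: "(conn R)\<inverse> = conn R"
  unfolding conn_def trancl_converse[symmetric] converse_Un converse_converse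
  by (simp only: Un_commute)

lemma trans_conn [simp]: "trans (conn R)" and trans_quo [simp]: "trans (quo R R')"
  by (simp_all add: conn_def quo_def)

lemma conn_increasing: "R \<union> R\<inverse> \<subseteq> conn R"
  by (auto simp: conn_def)

lemma quo_increasing: "R \<union> R'\<inverse> \<subseteq> quo R R'"
  by (auto simp: quo_def)

lemma conn_least: "R \<subseteq> W \<Longrightarrow> R\<inverse> \<subseteq> W \<Longrightarrow> trans W \<Longrightarrow> conn R \<subseteq> W"
  unfolding conn_def by (rule trancl_least) auto

lemma quo_least: "R \<subseteq> W \<Longrightarrow> R'\<inverse> \<subseteq> W \<Longrightarrow> trans W \<Longrightarrow> quo R R' \<subseteq> W"
  unfolding quo_def by (rule trancl_least) auto

lemma conn_mono: "R \<subseteq> S \<Longrightarrow> conn R \<subseteq> conn S"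
  using conn_increasing[of S] by - (rule conn_least, auto)

lemma quo_mono: "R \<subseteq> S \<Longrightarrow> R' \<subseteq> S' \<Longrightarrow> quo R R' \<subseteq> quo S S'"
  using quo_increasing[of S S'] by - (rule quo_least, auto)

lemma conn_subset_quo: "R' \<subseteq> R \<Longrightarrow> conn R' \<subseteq> quo R R'"
  using quo_increasing[of R R'] by - (rule conn_least, auto)

lemma quo_self: "quo R R = conn R"
  by (simp add: quo_def conn_def)

text \<open>The quotient adds only reversals of pairs of \<open>R'\<close>, which lie in
  \<open>R\<close> already, so no components merge. Hence \<open>quo V U\<close> still knows the
  components of \<open>V\<close>.\<close>

lemma conn_quo:
  assumes "R' \<subseteq> R"
  shows "conn (quo R R') = conn R"
proof
  have *: "quo R R' \<subseteq> conn R"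
    using conn_increasing[of R] assms by - (rule quo_least, auto)
  then have "(quo R R')\<inverse> \<subseteq> conn R"
    using conn_converse[of R] by blast
  with * show "conn (quo R R') \<subseteq> conn R"
    by - (rule conn_least, auto)
qed (intro conn_mono, use quo_increasing[of R R'] in simp)

text \<open>The analogue of the third isomorphism theorem. A reversed path of \<open>quo V U\<close>
  consists of steps of \<open>V\<inverse>\<close> and of \<open>U\<close>, all available in
  \<open>quo R V\<close>.\<close>

lemma quo_quo:
  assumes "U \<subseteq> V" "V \<subseteq> R"
  shows "quo (quo R U) (quo V U) = quo R V"
proof
  have "quo R U \<subseteq> quo R V"
    using assms by (intro quo_mono) auto
  moreover have "quo V U \<subseteq> (quo R V)\<inverse>"
    using assms quo_increasing[of R V] by - (rule quo_least, auto)
  ultimately show "quo (quo R U) (quo V U) \<subseteq> quo R V"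
    by - (rule quo_least, auto)
next
  show "quo R V \<subseteq> quo (quo R U) (quo V U)"
    using quo_increasing[of R U] quo_increasing[of V U] quo_increasing[of "quo R U" "quo V U"]
    by - (rule quo_least, auto)
qed

text \<open>The pair \<open>(y, x)\<close> closes the path to a cycle of \<open>W\<close>, and all
  points of a cycle are equivalent for \<open>W\<close>. In the induction the way back from an
  intermediate point is the next step followed by the way back from its end.\<close>

lemma trancl_in_cycle:
  assumes "(x, y) \<in> P\<^sup>+" "(y, x) \<in> W" "P \<subseteq> W" "trans W"
  shows "(x, y) \<in> (P \<inter> (W \<inter> W\<inverse>))\<^sup>+"
  using assms(1,2)
proof (induction rule: trancl_induct)
  case (base y)
  then show ?case using assms(3) by blast
next
  case (step y z)
  have yz: "(y, z) \<in> W" and xy: "(x, y) \<in> W"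
    using step.hyps assms(3) trancl_least[OF assms(3,4)] by auto
  have "(y, x) \<in> W" "(z, y) \<in> W"
    using transD[OF assms(4)] yz xy step.prems by blast+
  then have "(x, y) \<in> (P \<inter> (W \<inter> W\<inverse>))\<^sup>+" "(y, z) \<in> P \<inter> (W \<inter> W\<inverse>)"
    using step yz by auto
  then show ?case by (rule trancl_into_trancl)
qed

text \<open>The inclusion required by \<open>adm\<close> is an equality, since
  \<open>conn R'\<close> is symmetric and generated by steps of the quotient.\<close>

lemma adm_sym: "adm R' R \<Longrightarrow> quo R R' \<inter> (quo R R')\<inverse> = conn R'"
proof -
  assume a: "adm R' R"
  then have "conn R' \<subseteq> quo R R'"
    by (intro conn_subset_quo) (simp add: adm_def)
  moreover from this have "conn R' \<subseteq> (quo R R')\<inverse>"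
    by (simp add: converse_subset_swap)
  ultimately show ?thesis
    using a by (simp add: adm_def subset_antisym)
qed

lemma adm_int: "adm R' R \<Longrightarrow> R \<inter> conn R' = R'"
  using conn_increasing[of R'] unfolding adm_def by blast

text \<open>A path of the finer quotient whose ends are connected for \<open>V\<close> lies on a cycle of
  \<open>quo R V\<close>, hence in a single component of \<open>V\<close>.\<close>

lemma quo_int_conn:
  assumes V: "adm V R" and U: "U \<subseteq> V"
  shows "quo R U \<inter> conn V = quo V U"
proof
  have "(x, y) \<in> quo V U" if xy: "(x, y) \<in> quo R U" "(x, y) \<in> conn V" for x y
  proof -
    have "(y, x) \<in> quo R V"
      using xy(2) adm_sym[OF V] by blast
    moreover have "R \<union> U\<inverse> \<subseteq> quo R V"
      using quo_increasing[of R V] U by blast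
    ultimately have "(x, y) \<in> ((R \<union> U\<inverse>) \<inter> conn V)\<^sup>+"
      using trancl_in_cycle[of x y "R \<union> U\<inverse>" "quo R V"] xy(1) adm_sym[OF V]
      unfolding quo_def[of R U] by simp
    \<comment> \<open>Inside a component of \<open>V\<close>, admissibility turns steps of
      \<open>R\<close> into steps of \<open>V\<close>.\<close>
    moreover have "(R \<union> U\<inverse>) \<inter> conn V \<subseteq> V \<union> U\<inverse>"
      using adm_int[OF V] by blast
    ultimately show ?thesis
      unfolding quo_def by (rule trancl_mono)
  qed
  then show "quo R U \<inter> conn V \<subseteq> quo V U" by auto
next
  have "V \<subseteq> R" using V by (simp add: adm_def)
  then show "quo V U \<subseteq> quo R U \<inter> conn V"
    using quo_mono[of V R U U] conn_quo[OF U] conn_increasing[of "quo V U"] by auto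
qed

section \<open>Towers of admissible refinements\<close>

lemma adm_refl: "adm R R"
  by (auto simp: adm_def quo_self)

text \<open>A cycle of \<open>quo R U\<close> is also one of \<open>quo R V\<close>, hence stays in
  a component of \<open>V\<close>. There \<open>quo R U\<close> agrees with \<open>quo V U\<close>,
  and admissibility of \<open>U\<close> in \<open>V\<close> applies.\<close>

lemma adm_trans:
  assumes U: "adm U V" and V: "adm V R"
  shows "adm U R"
  unfolding adm_def
proof (intro conjI)
  have UV: "U \<subseteq> V" and VR: "V \<subseteq> R"
    using U V by (auto simp: adm_def)
  show "U \<subseteq> R" using UV VR by simp
  show "R \<inter> conn U \<subseteq> U"
    using adm_int[OF U] adm_int[OF V] conn_mono[OF UV] by blast
  have "quo R U \<inter> (quo R U)\<inverse> \<subseteq> conn V"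
    using quo_mono[of R R U V] UV adm_sym[OF V] by blast
  then have "quo R U \<inter> (quo R U)\<inverse> \<subseteq> quo V U \<inter> (quo V U)\<inverse>"
    using quo_int_conn[OF V UV] conn_converse[of V] by blast
  then show "quo R U \<inter> (quo R U)\<inverse> \<subseteq> conn U"
    using adm_sym[OF U] by simp
qed

text \<open>After rewriting with \<open>quo_quo\<close> and \<open>conn_quo\<close>, the three
  conditions are monotonicity of the quotient, \<open>quo_int_conn\<close>, and
  \<open>adm_sym\<close> for \<open>V\<close> in \<open>R\<close>.\<close>

lemma adm_quo:
  assumes V: "adm V R" and U: "U \<subseteq> V"
  shows "adm (quo V U) (quo R U)"
proof -
  have VR: "V \<subseteq> R" using V by (simp add: adm_def)
  show ?thesis
    unfolding adm_def quo_quo[OF U VR] conn_quo[OF U] adm_sym[OF V] quo_int_conn[OF V U]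
    using quo_mono[OF VR] by auto
qed

text \<open>The refinement of \<open>R\<close> that lies over an admissible refinement \<open>S\<close> of \<open>quo R U\<close>
  is cut out by the components of \<open>S\<close>.\<close>

lemma adm_lift:
  assumes U: "adm U R" and S: "adm S (quo R U)" and CS: "conn U \<subseteq> S"
  defines "V \<equiv> R \<inter> conn S"
  shows "adm U V" "adm V R" "quo V U = S"
proof -
  have UR: "U \<subseteq> R" using U by (simp add: adm_def)
  have U_S: "U \<subseteq> S" "U\<inverse> \<subseteq> S" and UV: "U \<subseteq> V"
    using CS conn_increasing[of U] conn_increasing[of S] UR by (auto simp: V_def)
  show eq: "quo V U = S"
  proof
    have "V \<subseteq> S"
      using adm_int[OF S] quo_increasing[of R U] by (auto simp: V_def)
    \<comment> \<open>\<open>S\<close> is the intersection of \<open>quo R U\<close> with its own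
      components, and both are transitive.\<close>
    moreover have "trans S"
      using adm_int[OF S] trans_Int[of "quo R U" "conn S"] by simp
    ultimately show "quo V U \<subseteq> S"
      using U_S by - (rule quo_least, auto)
  next
    show "S \<subseteq> quo V U"
    proof clarify
      fix x y assume xy: "(x, y) \<in> S"
      \<comment> \<open>\<open>?W\<close> contains the reversal of every pair of \<open>S\<close>. A
        path of \<open>quo R U\<close> joining such a pair therefore lies on a cycle of
        \<open>?W\<close>, that is, in one component of \<open>S\<close>.\<close>
      let ?W = "quo (quo R U) S"
      have W: "?W \<inter> ?W\<inverse> = conn S" by (rule adm_sym[OF S])
      have "(y, x) \<in> ?W"
        using xy quo_increasing[of "quo R U" S] by blast
      moreover have "R \<union> U\<inverse> \<subseteq> ?W"
        using quo_increasing[of "quo R U" S] quo_increasing[of R U] by blast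
      moreover have "(x, y) \<in> (R \<union> U\<inverse>)\<^sup>+"
        using xy S by (auto simp: adm_def quo_def)
      ultimately have "(x, y) \<in> ((R \<union> U\<inverse>) \<inter> conn S)\<^sup>+"
        using trancl_in_cycle[of x y "R \<union> U\<inverse>" ?W] W by simp
      moreover have "(R \<union> U\<inverse>) \<inter> conn S \<subseteq> V \<union> U\<inverse>"
        by (auto simp: V_def)
      ultimately show "(x, y) \<in> quo V U"
        unfolding quo_def by (rule trancl_mono)
    qed
  qed
  have VR: "V \<subseteq> R" by (simp add: V_def)
  \<comment> \<open>With the components of \<open>S\<close> and \<open>V\<close> equal, the
    definition of \<open>V\<close> is itself the restriction condition.\<close>
  have cV: "conn V = conn S"
    using conn_quo[OF UV] eq by simp
  have "quo R V = quo (quo R U) S"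
    using quo_quo[OF UV VR] eq by simp
  then show "adm V R"
    using VR cV adm_sym[OF S] by (auto simp: adm_def V_def)
  show "adm U V"
    unfolding adm_def
  proof (intro conjI)
    show "V \<inter> conn U \<subseteq> U"
      using adm_int[OF U] VR by blast
    show "quo V U \<inter> (quo V U)\<inverse> \<subseteq> conn U"
      using quo_mono[OF VR, of U U] adm_sym[OF U] by blast
  qed (rule UV)
qed

text \<open>The quotient retains the components, and these determine an admissible
  refinement.\<close>

lemma adm_eqI:
  assumes "adm V R" "adm V' R" "U \<subseteq> V" "U \<subseteq> V'" "quo V U = quo V' U"
  shows "V = V'"
proof -
  have "conn V = conn V'"
    using conn_quo[OF assms(3)] conn_quo[OF assms(4)] assms(5) by simp
  then show ?thesis
    using adm_int[OF assms(1)] adm_int[OF assms(2)] by metis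
qed

section \<open>Symmetric refinements and symmetric quotients\<close>

lemma adm_subset: "adm R' R \<Longrightarrow> R' \<subseteq> R"
  by (simp add: adm_def)

text \<open>Equivalent points of \<open>R\<close> form a cycle of the quotient, so every admissible
  refinement contains \<open>R \<inter> R\<inverse>\<close>; a symmetric one can contain nothing
  else.\<close>

lemma adm_sym_iff:
  assumes "adm R' R"
  shows "sym R' \<longleftrightarrow> R' = R \<inter> R\<inverse>"
proof
  assume "sym R'"
  then have "R'\<inverse> = R'"
    by (simp only: sym_conv_converse_eq)
  then have "R' \<subseteq> R \<inter> R\<inverse>"
    using adm_subset[OF assms] converse_subset_swap[of R' R] by simp
  moreover have "R \<inter> R\<inverse> \<subseteq> quo R R' \<inter> (quo R R')\<inverse>"
    using quo_increasing[of R R'] by auto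
  then have "R \<inter> R\<inverse> \<subseteq> conn R'"
    by (simp only: adm_sym[OF assms])
  then have "R \<inter> R\<inverse> \<subseteq> R'"
    using adm_int[OF assms] by blast
  ultimately show "R' = R \<inter> R\<inverse>"
    by (rule subset_antisym)
next
  assume "R' = R \<inter> R\<inverse>"
  moreover have "sym (R \<inter> R\<inverse>)"
    by (rule symI) blast
  ultimately show "sym R'"
    by (simp only:)
qed

text \<open>A symmetric quotient coincides with its own equivalence relation \<open>conn R'\<close>.
  Then all of \<open>R\<close> lies within components of \<open>R'\<close>, where the two relations
  agree.\<close>

lemma quo_sym_iff:
  assumes "adm R' R"
  shows "sym (quo R R') \<longleftrightarrow> R' = R"
proof
  assume "sym (quo R R')"
  then have "(quo R R')\<inverse> = quo R R'"
    by (simp only: sym_conv_converse_eq)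
  then have "R \<subseteq> conn R'"
    using adm_sym[OF assms] quo_increasing[of R R'] by simp
  then show "R' = R"
    using adm_int[OF assms] by (simp only: Int_absorb2)
next
  assume "R' = R"
  then show "sym (quo R R')"
    by (simp only: quo_self sym_conv_converse_eq conn_converse)
qed

lemma quo_core:
  assumes "trans R" "D \<subseteq> R" "sym D"
  shows "quo R D = R"
proof
  show "quo R D \<subseteq> R"
    using assms by - (rule quo_least, auto dest: symD)
qed (use quo_increasing[of R D] in simp)

text \<open>The condition on \<open>T'\<close> in the sum defining the coaction, read off on quasi-orders.\<close>

definition coact_cond :: "('a \<times> 'a) set \<Rightarrow> 'a set \<Rightarrow> ('a \<times> 'a) set \<Rightarrow> bool" where
  "coact_cond R Y R' \<longleftrightarrow> quo R R' `` Y \<subseteq> Y \<and> (\<forall>(x, y)\<in>R'. x \<notin> Y \<longrightarrow> y \<notin> Y \<longrightarrow> (y, x) \<in> R')"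

text \<open>The step behind coassociativity of the coaction. Paths of \<open>quo V U\<close>
  starting outside \<open>Y\<close> never enter \<open>Y\<close>, so they can be reversed one step
  at a time.\<close>

lemma coact_cond_tower:
  assumes U: "adm U V" and V: "adm V R" and [simp]: "trans V"
  shows "coact_cond R Y V \<longleftrightarrow> coact_cond R Y U \<and> coact_cond (quo R U) Y (quo V U)"
proof -
  have UV: "U \<subseteq> V" and VR: "V \<subseteq> R"
    using U V by (auto simp: adm_def)
  have qq: "quo (quo R U) (quo V U) = quo R V"
    by (rule quo_quo[OF UV VR])
  \<comment> \<open>\<open>Y\<close> is closed under \<open>quo R V\<close>, whose symmetric part is
    \<open>conn V\<close>; so \<open>Y\<close> is a union of components of \<open>V\<close>, and
    each pair of \<open>quo V U\<close> stays within one.\<close>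
  have sat: "x \<in> Y \<longleftrightarrow> y \<in> Y" if "quo R V `` Y \<subseteq> Y" "(x, y) \<in> quo V U" for x y
  proof -
    have "(x, y) \<in> conn V"
      using that(2) conn_quo[OF UV] conn_increasing[of "quo V U"] by auto
    then show ?thesis
      using adm_sym[OF V] that(1) by blast
  qed
  have reverse: "(y, x) \<in> W\<^sup>+"
    if Y: "quo R V `` Y \<subseteq> Y" and xy: "(x, y) \<in> quo V U" and x: "x \<notin> Y"
      and W: "\<And>a b. (a, b) \<in> V \<union> U\<inverse> \<Longrightarrow> a \<notin> Y \<Longrightarrow> b \<notin> Y \<Longrightarrow> (b, a) \<in> W" for x y W
  proof -
    from xy have "(x, y) \<in> (V \<union> U\<inverse>)\<^sup>+" by (simp add: quo_def)
    then show ?thesis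
    proof (induction rule: trancl_induct)
      case (base y)
      then have "y \<notin> Y" using sat[OF Y, of x y] x by (auto simp: quo_def)
      then show ?case using W[OF base x] by blast
    next
      case (step y z)
      have "(x, z) \<in> quo V U"
        unfolding quo_def using step.hyps by (rule trancl_into_trancl)
      then have "y \<notin> Y" "z \<notin> Y"
        using sat[OF Y, of x y] sat[OF Y, of x z] x step.hyps(1) by (auto simp: quo_def)
      then have "(z, y) \<in> W" using W[OF step.hyps(2)] by blast
      then show ?case using step.IH by (rule trancl_into_trancl2)
    qed
  qed
  show ?thesis
  proof
    assume c: "coact_cond R Y V"
    then have Y: "quo R V `` Y \<subseteq> Y" by (simp add: coact_cond_def)
    have Vs: "(y, x) \<in> V" if "(x, y) \<in> V" "x \<notin> Y" "y \<notin> Y" for x y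
      using c that by (auto simp: coact_cond_def)
    have "coact_cond R Y U"
      unfolding coact_cond_def
    proof (intro conjI)
      show "quo R U `` Y \<subseteq> Y"
        using Y quo_mono[of R R U V] UV by blast
      show "\<forall>(x, y)\<in>U. x \<notin> Y \<longrightarrow> y \<notin> Y \<longrightarrow> (y, x) \<in> U"
        \<comment> \<open>The reversed pair lies in \<open>V\<close> and in \<open>conn U\<close>,
          hence in \<open>U\<close>.\<close>
        using Vs UV adm_int[OF U] conn_increasing[of U] by blast
    qed
    moreover have "(y, x) \<in> quo V U" if "(x, y) \<in> quo V U" "x \<notin> Y" for x y
    proof -
      have "(y, x) \<in> V\<^sup>+"
        by (rule reverse[OF Y that]) (use Vs UV in blast)
      then show ?thesis
        using quo_increasing[of V U] by (auto simp: trancl_id)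
    qed
    ultimately show "coact_cond R Y U \<and> coact_cond (quo R U) Y (quo V U)"
      using Y qq by (auto simp: coact_cond_def)
  next
    assume c: "coact_cond R Y U \<and> coact_cond (quo R U) Y (quo V U)"
    then have Y: "quo R V `` Y \<subseteq> Y" by (simp add: coact_cond_def qq)
    have "(y, x) \<in> V" if xy: "(x, y) \<in> V" "x \<notin> Y" "y \<notin> Y" for x y
    proof -
      have "(y, x) \<in> quo V U"
        using c xy quo_increasing[of V U] by (auto simp: coact_cond_def)
      \<comment> \<open>The reversal in the quotient is lifted back to \<open>V\<close>. The path
        stays outside \<open>Y\<close>, where \<open>U\<close> is symmetric, so its steps in
        \<open>U\<inverse>\<close> are steps of \<open>U\<close> and hence of
        \<open>V\<close>.\<close>
      then have "(y, x) \<in> (V \<union> U\<inverse>)\<^sup>+" by (simp add: quo_def)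
      then show ?thesis using xy(3)
      proof (induction rule: converse_trancl_induct)
        case (base y)
        then show ?case
          using c xy(2) UV by (auto simp: coact_cond_def)
      next
        case (step y z)
        have "z \<notin> Y"
          using step.hyps(1) step.prems sat[OF Y, of y z] by (auto simp: quo_def)
        then have "(y, z) \<in> V"
          using c step.hyps(1) step.prems UV by (auto simp: coact_cond_def)
        then show ?case
          using step.IH[OF \<open>z \<notin> Y\<close>] \<open>trans V\<close> by (blast dest: transD)
      qed
    qed
    with Y show "coact_cond R Y V" by (auto simp: coact_cond_def)
  qed
qed

section \<open>Admissible topologies as quasi-orders\<close>

lemma topology_eq_iff_top_le:
  assumes "finite (topspace T)"
  shows "S = T \<longleftrightarrow> topspace S = topspace T \<and> top_le S = top_le T"
proof
  assume eq: "topspace S = topspace T \<and> top_le S = top_le T"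
  then have "upper_topology (topspace S) (top_le S) = S"
    using assms by (intro upper_topology_top_le) simp
  then show "S = T"
    unfolding conjunct1[OF eq] conjunct2[OF eq] upper_topology_top_le[OF assms] by (rule sym)
qed simp

lemma top_le_top_quot_eq_quo:
  "topspace T' = topspace T \<Longrightarrow> top_le (top_quot T T') = quo (top_le T) (top_le T')"
  by (simp add: top_le_top_quot quo_def)

lemma openin_iff_top_le:
  assumes "finite (topspace T)"
  shows "openin T U \<longleftrightarrow> U \<subseteq> topspace T \<and> top_le T `` U \<subseteq> U"
proof -
  have "openin T U \<longleftrightarrow> openin (upper_topology (topspace T) (top_le T)) U"
    by (simp add: upper_topology_top_le[OF assms])
  then show ?thesis
    using top_le_subset[of T] unfolding openin_upper_topology by blast
qed

lemma finer_iff_top_le: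
  assumes "finite (topspace T)"
  shows "finer T' T \<longleftrightarrow> topspace T' = topspace T \<and> top_le T' \<subseteq> top_le T"
proof
  assume "finer T' T"
  then show "topspace T' = topspace T \<and> top_le T' \<subseteq> top_le T"
    by (auto simp: finer_def top_le_def)
next
  assume le: "topspace T' = topspace T \<and> top_le T' \<subseteq> top_le T"
  have "openin T' U" if "openin T U" for U
  proof -
    have "U \<subseteq> topspace T" "top_le T `` U \<subseteq> U"
      using that assms by (simp_all add: openin_iff_top_le)
    moreover from this have "top_le T' `` U \<subseteq> U"
      using le Image_mono[of "top_le T'" "top_le T" U U] by simp
    ultimately show ?thesis
      using le assms by (simp add: openin_iff_top_le)
  qed
  then show "finer T' T"
    using le by (simp add: finer_def)
qed

section \<open>Connected components and admissibility read off from the quasi-order\<close>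

lemma conn_subset_topspace: "conn (top_le T) \<subseteq> topspace T \<times> topspace T"
  unfolding conn_def by (rule trancl_subset_Sigma) (auto simp: top_le_def)

text \<open>The class of \<open>x\<close> and its complement are both upper sets, hence open, so a
  connected set containing \<open>x\<close> lies in the class.\<close>

lemma connectedin_imp_conn:
  assumes fin: "finite (topspace T)" and Y: "connectedin T Y" "x \<in> Y" "y \<in> Y"
  shows "(x, y) \<in> conn (top_le T)"
proof -
  let ?C = "conn (top_le T) `` {x}"
  have YT: "Y \<subseteq> topspace T"
    using connectedin_subset_topspace[OF Y(1)] .
  have x: "x \<in> ?C"
    using Y(2) YT conn_increasing[of "top_le T"] top_le_refl[of x T] by blast
  have step: "b \<in> ?C \<longleftrightarrow> a \<in> ?C" if "(a, b) \<in> top_le T" for a b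
  proof -
    have "(a, b) \<in> conn (top_le T)" "(b, a) \<in> conn (top_le T)"
      using that conn_increasing[of "top_le T"] by auto
    then show ?thesis
      using trans_conn[of "top_le T"] by (meson Image_singleton_iff transD)
  qed
  have "openin T ?C" "openin T (topspace T - ?C)"
    unfolding openin_iff_top_le[OF fin]
    using step conn_subset_topspace[of T] top_le_subset[of T] by blast+
  then have "Y \<inter> (topspace T - ?C) = {}"
    using Y(1,2) YT x unfolding connectedin by blast
  then show ?thesis
    using Y(3) YT by blast
qed

lemma connected_component_of_iff_conn:
  assumes "finite (topspace T)"
  shows "connected_component_of T x y \<longleftrightarrow> (x, y) \<in> conn (top_le T)"
proof
  assume "connected_component_of T x y"
  then show "(x, y) \<in> conn (top_le T)"
    using connectedin_imp_conn[OF assms] by (auto simp: connected_component_of_def)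
next
  assume "(x, y) \<in> conn (top_le T)"
  then show "connected_component_of T x y"
    unfolding conn_def
  proof (induction rule: trancl_induct)
    case (base y)
    then show ?case
      using connected_component_of_top_le connected_component_of_sym by fastforce
  next
    case (step y z)
    then have "connected_component_of T y z"
      using connected_component_of_top_le connected_component_of_sym by fastforce
    with step.IH show ?case
      by (rule connected_component_of_trans)
  qed
qed

lemma subtopology_eq_iff_top_le:
  assumes "finite (topspace T)" "topspace T' = topspace T" "Y \<subseteq> topspace T"
  shows "subtopology T' Y = subtopology T Y \<longleftrightarrow>
    (\<forall>x\<in>Y. \<forall>y\<in>Y. (x, y) \<in> top_le T' \<longleftrightarrow> (x, y) \<in> top_le T)"
proof -
  have "topspace (subtopology T' Y) = Y" "topspace (subtopology T Y) = Y"
    using assms(2,3) by auto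
  moreover have "finite Y"
    using assms(1,3) finite_subset by blast
  ultimately have "subtopology T' Y = subtopology T Y \<longleftrightarrow>
      top_le (subtopology T' Y) = top_le (subtopology T Y)"
    by (simp add: topology_eq_iff_top_le)
  moreover have "top_le (subtopology S Y) \<subseteq> Y \<times> Y" for S
    using top_le_subset[of "subtopology S Y"] by auto
  ultimately show ?thesis
    using top_le_subtopology[of _ Y _ T] top_le_subtopology[of _ Y _ T']
    by (smt (verit, best) mem_Sigma_iff subrelI subset_antisym subsetD)
qed

text \<open>The bridge to the relational part. It rests on \<open>conn\<close> relating exactly the
  pairs that lie in a common connected set.\<close>

lemma admissible_iff_adm:
  assumes fin: "finite (topspace T)"
  shows "admissible T' T \<longleftrightarrow> topspace T' = topspace T \<and> adm (top_le T') (top_le T)"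
proof (cases "finer T' T")
  case False
  then show ?thesis
    using finer_iff_top_le[OF fin] by (auto simp: admissible_def adm_def)
next
  case True
  then have sp: "topspace T' = topspace T" and le: "top_le T' \<subseteq> top_le T"
    by (simp_all add: finer_iff_top_le[OF fin])
  have fin': "finite (topspace T')" using fin sp by simp
  have "(\<forall>Y. connectedin T' Y \<longrightarrow> subtopology T' Y = subtopology T Y) \<longleftrightarrow>
      top_le T \<inter> conn (top_le T') \<subseteq> top_le T'"
  proof
    assume L: "\<forall>Y. connectedin T' Y \<longrightarrow> subtopology T' Y = subtopology T Y"
    show "top_le T \<inter> conn (top_le T') \<subseteq> top_le T'"
    proof clarify
      fix x y assume xy: "(x, y) \<in> top_le T" "(x, y) \<in> conn (top_le T')"
      then obtain Y where Y: "connectedin T' Y" "x \<in> Y" "y \<in> Y"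
        using connected_component_of_iff_conn[OF fin'] by (auto simp: connected_component_of_def)
      then have "Y \<subseteq> topspace T"
        using connectedin_subset_topspace sp by metis
      then show "(x, y) \<in> top_le T'"
        using L Y xy(1) subtopology_eq_iff_top_le[OF fin sp] by blast
    qed
  next
    assume R: "top_le T \<inter> conn (top_le T') \<subseteq> top_le T'"
    show "\<forall>Y. connectedin T' Y \<longrightarrow> subtopology T' Y = subtopology T Y"
    proof (intro allI impI)
      fix Y assume Y: "connectedin T' Y"
      then have "Y \<subseteq> topspace T"
        using connectedin_subset_topspace sp by metis
      then show "subtopology T' Y = subtopology T Y"
        using R le connectedin_imp_conn[OF fin' Y] subtopology_eq_iff_top_le[OF fin sp] by blast
    qed
  qed
  moreover have "(\<forall>x\<in>topspace T. \<forall>y\<in>topspace T.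
      (x, y) \<in> top_sim (top_quot T T') \<longleftrightarrow> (x, y) \<in> top_sim (top_quot T' T')) \<longleftrightarrow>
      quo (top_le T) (top_le T') \<inter> (quo (top_le T) (top_le T'))\<inverse> \<subseteq> conn (top_le T')"
    (is "?L \<longleftrightarrow> ?R")
  proof -
    have Q: "top_sim (top_quot T T') = quo (top_le T) (top_le T') \<inter> (quo (top_le T) (top_le T'))\<inverse>"
      and C: "top_sim (top_quot T' T') = conn (top_le T')"
      by (simp_all add: top_sim_def top_le_top_quot_eq_quo sp quo_self)
    have sub: "top_sim (top_quot S T') \<subseteq> topspace S \<times> topspace S" for S
      using top_le_subset[of "top_quot S T'"] by (auto simp: top_sim_def)
    \<comment> \<open>One of the two implications in (iii) always holds, so the equivalence over all
      pairs amounts to a single inclusion.\<close>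
    have "conn (top_le T') \<subseteq> quo (top_le T) (top_le T')"
      by (rule conn_subset_quo[OF le])
    moreover from this have "conn (top_le T') \<subseteq> (quo (top_le T) (top_le T'))\<inverse>"
      by (simp add: converse_subset_swap)
    ultimately have "top_sim (top_quot T' T') \<subseteq> top_sim (top_quot T T')"
      unfolding Q C by simp
    then have "?L \<longleftrightarrow> top_sim (top_quot T T') \<subseteq> top_sim (top_quot T' T')"
      using sub[of T] by blast
    then show ?thesis by (simp add: Q C)
  qed
  ultimately show ?thesis
    using True sp le unfolding admissible_def adm_def by simp
qed

lemma topspace_admissible: "admissible T' T \<Longrightarrow> topspace T' = topspace T"
  by (simp add: admissible_def finer_def)

lemma admissible_trans:
  assumes "finite (topspace T)" "admissible U V" "admissible V T"
  shows "admissible U T"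
  using assms topspace_admissible[OF assms(2)] topspace_admissible[OF assms(3)]
    adm_trans[of "top_le U" "top_le V" "top_le T"]
  by (simp add: admissible_iff_adm)

lemma admissible_refl: "finite (topspace T) \<Longrightarrow> admissible T T"
  by (simp add: admissible_iff_adm adm_refl)

lemma admissible_top_quot:
  assumes "finite (topspace T)" "admissible U V" "admissible V T"
  shows "admissible (top_quot V U) (top_quot T U)"
  using assms topspace_admissible[OF assms(2)] topspace_admissible[OF assms(3)]
    adm_quo[of "top_le V" "top_le T" "top_le U"]
  by (simp add: admissible_iff_adm adm_subset top_le_top_quot_eq_quo)

lemma top_quot_top_quot:
  assumes "finite (topspace T)" "admissible U V" "admissible V T"
  shows "top_quot (top_quot T U) (top_quot V U) = top_quot T V"
  using assms topspace_admissible[OF assms(2)] topspace_admissible[OF assms(3)]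
    quo_quo[of "top_le U" "top_le V" "top_le T"]
  by (simp add: topology_eq_iff_top_le admissible_iff_adm adm_subset top_le_top_quot_eq_quo)

section \<open>Reindexing sums over towers of admissible topologies\<close>

lemma finite_topologies:
  assumes "finite X"
  shows "finite {T. topspace T = X}"
proof (rule inj_on_finite)
  show "inj_on (\<lambda>T. {U. openin T U}) {T. topspace T = X}"
    by (auto simp: inj_on_def topology_eq)
  show "(\<lambda>T. {U. openin T U}) ` {T. topspace T = X} \<subseteq> Pow (Pow X)"
    using openin_subset by auto
qed (use assms in simp)

text \<open>A sum over an infinite index set is 0 by convention; finiteness gives the sums in the
  coproduct and the coaction their intended value.\<close>

lemma finite_admissible: "finite (topspace T) \<Longrightarrow> finite {T'. admissible T' T}"
  by (rule finite_subset[OF _ finite_topologies]) (auto dest: topspace_admissible)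

text \<open>Surjectivity of the map sending \<open>V\<close> to \<open>top_quot V U\<close>; the
  witness is the relation of \<open>adm_lift\<close> turned into a topology.\<close>

lemma admissible_lift:
  assumes fin: "finite (topspace T)" and U: "admissible U T" and S: "admissible S (top_quot T U)"
  obtains V where "admissible U V" "admissible V T" "top_quot V U = S"
proof -
  let ?R = "top_le T \<inter> conn (top_le S)"
  define V where "V = upper_topology (topspace T) ?R"
  have spU: "topspace U = topspace T" and spS: "topspace S = topspace T"
    using topspace_admissible[OF U] topspace_admissible[OF S] by simp_all
  have spV: "topspace V = topspace T" by (simp add: V_def)
  have aU: "adm (top_le U) (top_le T)" and aS: "adm (top_le S) (quo (top_le T) (top_le U))"
    using U S fin spU by (simp_all add: admissible_iff_adm top_le_top_quot_eq_quo)
  have leV: "top_le V = ?R"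
    unfolding V_def
  proof (rule top_le_upper_topology)
    show "?R \<subseteq> topspace T \<times> topspace T"
      using top_le_subset[of T] by blast
    show "(x, x) \<in> ?R" if "x \<in> topspace T" for x
      using that top_le_refl[of x T] top_le_refl[of x S] conn_increasing[of "top_le S"] spS by auto
  qed (intro trans_Int trans_top_le trans_conn)
  \<comment> \<open>The components of \<open>U\<close> are the equivalence classes of
    \<open>top_quot T U\<close>, and any admissible refinement of it keeps those
    equivalences.\<close>
  have "conn (top_le U) \<subseteq> top_le S"
  proof clarify
    fix x y assume "(x, y) \<in> conn (top_le U)"
    then have "(x, y) \<in> top_sim (top_quot T U)"
      using adm_sym[OF aU] spU by (simp add: top_sim_def top_le_top_quot_eq_quo)
    then show "(x, y) \<in> top_le S"
      using top_sim_admissible[OF S] by (simp add: top_sim_def)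
  qed
  note V = adm_lift[OF aU aS this, folded leV]
  show thesis
  proof (rule that[of V])
    show "admissible U V" "admissible V T"
      using V fin spU spV by (simp_all add: admissible_iff_adm)
    show "top_quot V U = S"
      using V(3) fin spU spV spS by (simp add: topology_eq_iff_top_le top_le_top_quot_eq_quo)
  qed
qed

lemma top_quot_inject:
  assumes fin: "finite (topspace T)" and "admissible U V" "admissible V T"
    "admissible U V'" "admissible V' T" "top_quot V U = top_quot V' U"
  shows "V = V'"
proof -
  have sp: "topspace V = topspace T" "topspace V' = topspace T" "topspace U = topspace T"
    using assms by (auto dest: topspace_admissible)
  have "quo (top_le V) (top_le U) = quo (top_le V') (top_le U)"
    using assms(6) sp top_le_top_quot_eq_quo[of U V] top_le_top_quot_eq_quo[of U V'] by simp
  moreover have "adm (top_le V) (top_le T)" "adm (top_le V') (top_le T)"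
    using assms(3,5) by (simp_all add: admissible_iff_adm[OF fin])
  moreover have "adm (top_le U) (top_le V)" "adm (top_le U) (top_le V')"
    using assms(2,4) fin sp by (simp_all add: admissible_iff_adm)
  ultimately have "top_le V = top_le V'"
    by (meson adm_eqI adm_subset)
  then show ?thesis
    using fin sp by (intro topology_eq_iff_top_le[THEN iffD2]) simp_all
qed

lemma sum_Collect_conj:
  "finite {x. P x} \<Longrightarrow> (\<Sum>x | P x \<and> Q x. f x) = (\<Sum>x | P x. if Q x then f x else 0)"
  using sum.inter_filter[of "{x. P x}" f Q] by simp

text \<open>Mapping \<open>(V, U)\<close> to \<open>(U, top_quot V U)\<close> is a bijection between
  the two index sets. Both coassociativity laws are instances of this change of variables.\<close>

lemma sum_admissible_tower:
  fixes g :: "'a topology \<Rightarrow> 'a topology \<Rightarrow> 'b::comm_monoid_add"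
  assumes fin: "finite (topspace T)"
  shows "(\<Sum>U | admissible U T. \<Sum>S | admissible S (top_quot T U). g U S) =
    (\<Sum>V | admissible V T. \<Sum>U | admissible U V. g U (top_quot V U))"
proof -
  let ?A = "SIGMA V:{V. admissible V T}. {U. admissible U V}"
  let ?B = "SIGMA U:{U. admissible U T}. {S. admissible S (top_quot T U)}"
  let ?f = "\<lambda>(V, U). (U, top_quot V U)"
  have "bij_betw ?f ?A ?B"
    unfolding bij_betw_def
  proof (intro conjI subset_antisym)
    show "inj_on ?f ?A"
      using top_quot_inject[OF fin] by (auto simp: inj_on_def)
    show "?f ` ?A \<subseteq> ?B"
      using admissible_trans[OF fin] admissible_top_quot[OF fin] by auto
    show "?B \<subseteq> ?f ` ?A"
    proof clarify
      fix U S assume U: "admissible U T" and S: "admissible S (top_quot T U)"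
      obtain V where "admissible U V" "admissible V T" "top_quot V U = S"
        using admissible_lift[OF fin U S] .
      then show "(U, S) \<in> ?f ` ?A"
        by (intro image_eqI[of _ _ "(V, U)"]) auto
    qed
  qed
  then have "(\<Sum>(U, S)\<in>?B. g U S) = (\<Sum>p\<in>?A. case ?f p of (U, S) \<Rightarrow> g U S)"
    by (rule sum.reindex_bij_betw[symmetric])
  also have "\<dots> = (\<Sum>(V, U)\<in>?A. g U (top_quot V U))"
    by (intro sum.cong) auto
  finally have "(\<Sum>(U, S)\<in>?B. g U S) = (\<Sum>(V, U)\<in>?A. g U (top_quot V U))" .
  moreover have "finite {S. admissible S (top_quot T U)}" for U
    using fin by (intro finite_admissible) simp
  moreover have "finite {U. admissible U V}" if "admissible V T" for V
    using fin topspace_admissible[OF that] by (intro finite_admissible) simp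
  ultimately show ?thesis
    using finite_admissible[OF fin] by (simp add: sum.Sigma)
qed

section \<open>The finest admissible topology and the counit condition\<close>

lemma top_le_finest_admissible: "top_le (finest_admissible T) = top_sim T"
proof -
  have "top_sim T \<subseteq> topspace T \<times> topspace T" "refl_on (topspace T) (top_sim T)" "trans (top_sim T)"
    using equiv_top_sim[of T] by (auto simp: equiv_def)
  then show ?thesis
    unfolding finest_admissible_eq by (intro top_le_upper_topology) (auto simp: refl_on_def)
qed

lemma topspace_finest_admissible [simp]: "topspace (finest_admissible T) = topspace T"
  by (simp add: finest_admissible_eq)

lemma sym_top_sim: "sym (top_sim T)"
  by (rule symI) (auto simp: top_sim_def)

lemma eq_finest_admissible_iff:
  assumes "finite (topspace T)"
  shows "T = finest_admissible T \<longleftrightarrow> sym (top_le T)"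
proof
  assume "T = finest_admissible T"
  then show "sym (top_le T)"
    using top_le_finest_admissible[of T] sym_top_sim[of T] by simp
next
  assume "sym (top_le T)"
  then have "(top_le T)\<inverse> = top_le T"
    by (simp only: sym_conv_converse_eq)
  then have "top_le T = top_le (finest_admissible T)"
    unfolding top_le_finest_admissible top_sim_def by simp
  then show "T = finest_admissible T"
    using assms by (simp add: topology_eq_iff_top_le)
qed

lemma admissible_sym_iff:
  assumes "finite (topspace T)" "admissible U T"
  shows "sym (top_le U) \<longleftrightarrow> U = finest_admissible T"
  using assms topspace_admissible[OF assms(2)] adm_sym_iff[of "top_le U" "top_le T"]
  by (simp add: admissible_iff_adm topology_eq_iff_top_le top_le_finest_admissible top_sim_def)

lemma top_quot_sym_iff:
  assumes "finite (topspace T)" "admissible U T"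
  shows "sym (top_le (top_quot T U)) \<longleftrightarrow> U = T"
  using assms topspace_admissible[OF assms(2)] quo_sym_iff[of "top_le U" "top_le T"]
  by (simp add: admissible_iff_adm topology_eq_iff_top_le top_le_top_quot_eq_quo)

text \<open>Only pairs already equivalent in \<open>T\<close> are reversed. Allowing
  \<open>T'\<close> below \<open>T\<close> serves the left counit law of \<open>Gamma_cop\<close>,
  where the finest refinement of \<open>T'\<close> divides both \<open>T\<close> and
  \<open>T'\<close>.\<close>

lemma top_quot_finest_admissible:
  assumes "finite (topspace T)" "admissible T' T"
  shows "top_quot T (finest_admissible T') = T"
proof -
  have "top_sim T' \<subseteq> top_le T"
    using assms topspace_admissible[OF assms(2)]
    by (auto simp: admissible_iff_adm adm_def top_sim_def)
  then have "quo (top_le T) (top_sim T') = top_le T"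
    using quo_core sym_top_sim trans_top_le by blast
  then show ?thesis
    using assms topspace_admissible[OF assms(2)]
    by (simp add: topology_eq_iff_top_le top_le_top_quot_eq_quo top_le_finest_admissible)
qed

text \<open>Sending each equivalence class to its component is a surjection of finite sets, so equal
  cardinality means injectivity. Comparable points share a component, so injectivity makes them
  equivalent.\<close>

lemma card_sim_eq_card_components_iff:
  assumes fin: "finite (topspace T)"
  shows "card (topspace T // top_sim T) = card (connected_components_of T) \<longleftrightarrow> sym (top_le T)"
proof -
  let ?X = "topspace T" and ?C = "conn (top_le T)"
  have symC: "sym ?C"
    by (simp only: sym_conv_converse_eq conn_converse)
  have sim_C: "top_sim T \<subseteq> ?C"
    using conn_increasing[of "top_le T"] by (auto simp: top_sim_def)
  have eqS: "equiv ?X (top_sim T)" by (rule equiv_top_sim)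
  have eqC: "equiv ?X ?C"
  proof (rule equivI)
    show "refl_on ?X ?C"
      using conn_increasing[of "top_le T"] top_le_refl[of _ T] by (auto simp: refl_on_def)
  qed (use conn_subset_topspace symC in auto)
  have comps: "connected_components_of T = ?X // ?C"
    unfolding connected_components_of_def quotient_def
    by (auto simp: connected_component_of_iff_conn[OF fin] Image_def)
  have img: "(\<lambda>Z. ?C `` Z) ` (?X // top_sim T) = ?X // ?C"
    by (rule refines_equiv_image_eq[OF sim_C eqS eqC])
  have finq: "finite (?X // top_sim T)"
    using fin eqS by (intro finite_quotient) (auto simp: equiv_def)
  show ?thesis
  proof
    assume "card (?X // top_sim T) = card (connected_components_of T)"
    then have inj: "inj_on (\<lambda>Z. ?C `` Z) (?X // top_sim T)"
      using img finq comps by (intro eq_card_imp_inj_on) auto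
    show "sym (top_le T)"
    proof (rule symI)
      fix x y assume xy: "(x, y) \<in> top_le T"
      then have X: "x \<in> ?X" "y \<in> ?X" and "(x, y) \<in> ?C"
        using conn_increasing[of "top_le T"] by (auto simp: top_le_def)
      then have "?C `` (top_sim T `` {x}) = ?C `` (top_sim T `` {y})"
        by (simp only: refines_equiv_class_eq2[OF sim_C eqS eqC] equiv_class_eq[OF eqC])
      then have "top_sim T `` {x} = top_sim T `` {y}"
        by (rule inj_onD[OF inj]) (use X in \<open>simp_all add: quotientI\<close>)
      then have "(x, y) \<in> top_sim T"
        using eq_equiv_class[OF _ eqS X(2)] by simp
      then show "(y, x) \<in> top_le T"
        by (simp add: top_sim_def)
    qed
  next
    assume "sym (top_le T)"
    then have "(top_le T)\<inverse> = top_le T"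
      by (simp only: sym_conv_converse_eq)
    then have "?C = top_sim T"
      using trans_top_le[of T] by (simp add: conn_def top_sim_def trancl_id)
    then show "card (?X // top_sim T) = card (connected_components_of T)"
      by (simp add: comps)
  qed
qed

section \<open>The index condition of the coaction\<close>

definition coact_admissible :: "'a topology \<Rightarrow> 'a set \<Rightarrow> 'a topology \<Rightarrow> bool" where
  "coact_admissible T Y T' \<longleftrightarrow> openin (top_quot T T') Y \<and>
     subtopology T' (topspace T - Y) = finest_admissible (subtopology T' (topspace T - Y))"

text \<open>A finite topology equals its finest admissible topology exactly when its quasi-order is
  symmetric; so the restriction condition says that \<open>T'\<close> is symmetric off
  \<open>Y\<close>.\<close>

lemma coact_admissible_iff:
  assumes fin: "finite (topspace T)" and "Y \<subseteq> topspace T" and sp: "topspace T' = topspace T"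
  shows "coact_admissible T Y T' \<longleftrightarrow> coact_cond (top_le T) Y (top_le T')"
proof -
  let ?Z = "topspace T - Y"
  have "openin (top_quot T T') Y \<longleftrightarrow> quo (top_le T) (top_le T') `` Y \<subseteq> Y"
    using assms by (simp add: openin_iff_top_le top_le_top_quot_eq_quo)
  moreover have "sym (top_le (subtopology T' ?Z)) \<longleftrightarrow>
      (\<forall>(x, y)\<in>top_le T'. x \<notin> Y \<longrightarrow> y \<notin> Y \<longrightarrow> (y, x) \<in> top_le T')"
    using top_le_subset[of T'] top_le_subset[of "subtopology T' ?Z"] top_le_subtopology[of _ ?Z _ T']
    unfolding sym_def sp topspace_subtopology by blast
  moreover have "finite (topspace (subtopology T' ?Z))"
    using fin by simp
  ultimately show ?thesis
    unfolding coact_admissible_def coact_cond_def by (simp add: eq_finest_admissible_iff)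
qed

lemma coact_admissible_tower:
  assumes fin: "finite (topspace T)" and Y: "Y \<subseteq> topspace T"
    and U: "admissible U V" and V: "admissible V T"
  shows "coact_admissible T Y V \<longleftrightarrow>
    coact_admissible T Y U \<and> coact_admissible (top_quot T U) Y (top_quot V U)"
  using coact_cond_tower[of "top_le U" "top_le V" "top_le T" Y] assms trans_top_le[of V]
    topspace_admissible[OF U] topspace_admissible[OF V]
  by (simp add: coact_admissible_iff admissible_iff_adm top_le_top_quot_eq_quo)

text \<open>The quotient by the finest topology is \<open>T\<close> itself, so \<open>Y\<close>
  stays open. This places the one index selected by the counit in the sum of
  \<open>Phi\<close>.\<close>

lemma coact_admissible_finest:
  assumes "finite (topspace T)" "openin T Y"
  shows "coact_admissible T Y (finest_admissible T)"
proof -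
  let ?D = "finest_admissible T"
  have Y: "Y \<subseteq> topspace T" "top_le T `` Y \<subseteq> Y"
    using assms by (simp_all add: openin_iff_top_le)
  have "quo (top_le T) (top_le ?D) = top_le T"
    unfolding top_le_finest_admissible
    by (rule quo_core[OF trans_top_le _ sym_top_sim]) (simp add: top_sim_def)
  then have "coact_cond (top_le T) Y (top_le ?D)"
    using Y sym_top_sim[of T] unfolding coact_cond_def top_le_finest_admissible
    by (auto dest: symD)
  then show ?thesis
    using assms(1) Y(1) by (simp add: coact_admissible_iff)
qed


section \<open>The coalgebra and its coaction\<close>

lemma linear_comp:
  "Vector_Spaces.linear s1 s2 f \<Longrightarrow> Vector_Spaces.linear s2 s3 g \<Longrightarrow>
    Vector_Spaces.linear s1 s3 (\<lambda>v. g (f v))"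
  using Vector_Spaces.linear_compose[of s1 s2 f s3 g] by (simp add: comp_def)

lemma linear_tensor_map: "Vector_Spaces.linear fscale fscale (tensor_map f g)"
  and linear_tensor_assoc: "Vector_Spaces.linear fscale fscale tensor_assoc"
  and linear_counit_left: "Vector_Spaces.linear fscale fscale (counit_left \<epsilon>)"
  and linear_counit_right: "Vector_Spaces.linear fscale fscale (counit_right \<epsilon>)"
  and linear_Gamma_cop: "Vector_Spaces.linear fscale fscale Gamma_cop"
  and linear_Phi: "Vector_Spaces.linear fscale fscale Phi"
  unfolding tensor_map_def tensor_assoc_def counit_left_def counit_right_def Gamma_cop_def Phi_def
  by (rule linear_lin_ext_fscale)+

lemma linear_ident: "Vector_Spaces.linear fscale fscale (\<lambda>v. v)"
  by (rule vector_space.linear_ident[OF vector_space_fscale])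

lemma Gamma_cop_bvec:
  "Gamma_cop (bvec (T, T')) =
    (\<Sum>U | admissible U T'. bvec ((T, U), (top_quot T U, top_quot T' U)))"
  by (simp add: Gamma_cop_def tensor_bvec)

lemma Phi_bvec:
  "Phi (bvec (T, Y)) =
    (\<Sum>U | admissible U T \<and> coact_admissible T Y U. bvec ((T, U), (top_quot T U, Y)))"
  by (simp add: Phi_def tensor_bvec coact_admissible_def)

lemma counit_bvec:
  assumes "finite (topspace T')"
  shows "counit (bvec (T, T')) = (if sym (top_le T') then 1 else 0)"
  using card_sim_eq_card_components_iff[OF assms]
  by (simp add: counit_def lin_ext_bvec[OF vector_space_mult])

section \<open>Coassociativity\<close>

lemma Gamma_coassoc:
  assumes fin: "finite (topspace T)" and adm: "admissible T' T"
  shows "tensor_map id Gamma_cop (Gamma_cop (bvec (T, T'))) =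
    tensor_assoc (tensor_map Gamma_cop id (Gamma_cop (bvec (T, T'))))"
proof -
  have fin': "finite (topspace T')"
    using fin topspace_admissible[OF adm] by simp
  have "tensor_map id Gamma_cop (Gamma_cop (bvec (T, T'))) =
      (\<Sum>U | admissible U T'. \<Sum>S | admissible S (top_quot T' U).
        bvec ((T, U), (top_quot T U, S), (top_quot (top_quot T U) S, top_quot (top_quot T' U) S)))"
    by (simp add: Gamma_cop_bvec tensor_map_sum tensor_map_id_bvec bvec_tensor_sum)
  \<comment> \<open>The tower lies below \<open>T'\<close>; \<open>T\<close> occurs only in the
    summands.\<close>
  also have "\<dots> = (\<Sum>V | admissible V T'. \<Sum>U | admissible U V.
        bvec ((T, U), (top_quot T U, top_quot V U),
          (top_quot (top_quot T U) (top_quot V U), top_quot (top_quot T' U) (top_quot V U))))"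
    by (rule sum_admissible_tower[OF fin'])
  \<comment> \<open>Iterated quotients collapse. For \<open>T\<close> this uses that
    \<open>V\<close>, being admissible for \<open>T'\<close>, is admissible for
    \<open>T\<close>.\<close>
  also have "\<dots> = (\<Sum>V | admissible V T'. \<Sum>U | admissible U V.
        bvec ((T, U), (top_quot T U, top_quot V U), (top_quot T V, top_quot T' V)))"
    by (intro sum.cong refl) (simp add: top_quot_top_quot fin fin' admissible_trans[OF fin _ adm])
  also have "\<dots> = tensor_assoc (tensor_map Gamma_cop id (Gamma_cop (bvec (T, T'))))"
    by (simp add: Gamma_cop_bvec tensor_map_sum tensor_assoc_sum tensor_map_bvec_id sum_tensor_bvec)
  finally show ?thesis .
qed

lemma Phi_coassoc:
  assumes fin: "finite (topspace T)" and Y: "openin T Y"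
  shows "tensor_map id Phi (Phi (bvec (T, Y))) =
    tensor_assoc (tensor_map Gamma_cop id (Phi (bvec (T, Y))))"
proof -
  have YT: "Y \<subseteq> topspace T" using openin_subset[OF Y] .
  have fin_adm: "finite {U. admissible U S}" if "topspace S = topspace T" for S
    using fin that by (intro finite_admissible) simp
  have "tensor_map id Phi (Phi (bvec (T, Y))) =
      (\<Sum>U | admissible U T \<and> coact_admissible T Y U.
        \<Sum>S | admissible S (top_quot T U) \<and> coact_admissible (top_quot T U) Y S.
        bvec ((T, U), (top_quot T U, S), (top_quot (top_quot T U) S, Y)))"
    by (simp add: Phi_bvec tensor_map_sum tensor_map_id_bvec bvec_tensor_sum)
  \<comment> \<open>The extra conditions move into the summand so that the reindexing of all towers
    applies.\<close>
  also have "\<dots> = (\<Sum>U | admissible U T. \<Sum>S | admissible S (top_quot T U).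
        if coact_admissible T Y U \<and> coact_admissible (top_quot T U) Y S
        then bvec ((T, U), (top_quot T U, S), (top_quot (top_quot T U) S, Y)) else 0)"
    unfolding sum_Collect_conj[OF fin_adm[OF refl]] sum_Collect_conj[OF fin_adm[OF topspace_top_quot]]
    by (intro sum.cong refl) simp
  also have "\<dots> = (\<Sum>V | admissible V T. \<Sum>U | admissible U V.
        if coact_admissible T Y U \<and> coact_admissible (top_quot T U) Y (top_quot V U)
        then bvec ((T, U), (top_quot T U, top_quot V U),
          (top_quot (top_quot T U) (top_quot V U), Y)) else 0)"
    by (rule sum_admissible_tower[OF fin])
  \<comment> \<open>By \<open>coact_admissible_tower\<close> the two conditions merge into one on
    \<open>V\<close> alone, which can then leave the inner sum.\<close>
  also have "\<dots> = (\<Sum>V | admissible V T. \<Sum>U | admissible U V.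
        if coact_admissible T Y V
        then bvec ((T, U), (top_quot T U, top_quot V U), (top_quot T V, Y)) else 0)"
    by (intro sum.cong refl)
      (simp add: top_quot_top_quot[OF fin] coact_admissible_tower[OF fin YT, symmetric])
  also have "\<dots> = (\<Sum>V | admissible V T \<and> coact_admissible T Y V. \<Sum>U | admissible U V.
        bvec ((T, U), (top_quot T U, top_quot V U), (top_quot T V, Y)))"
    unfolding sum_Collect_conj[OF fin_adm[OF refl]]
    by (intro sum.cong refl) simp
  also have "\<dots> = tensor_assoc (tensor_map Gamma_cop id (Phi (bvec (T, Y))))"
    by (simp add: Phi_bvec Gamma_cop_bvec tensor_map_sum tensor_assoc_sum tensor_map_bvec_id
        sum_tensor_bvec)
  finally show ?thesis .
qed

section \<open>Counit laws\<close>

lemma Gamma_counit_left: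
  assumes fin: "finite (topspace T)" and adm: "admissible T' T"
  shows "counit_left counit (Gamma_cop (bvec (T, T'))) = (bvec (T, T') :: _ \<Rightarrow>\<^sub>0 'k::field)"
proof -
  have fin': "finite (topspace T')"
    using fin topspace_admissible[OF adm] by simp
  \<comment> \<open>The counit of \<open>(T, U)\<close> vanishes unless \<open>U\<close> is
    symmetric, and the only symmetric admissible refinement of \<open>T'\<close> is the
    finest.\<close>
  have "counit_left counit (Gamma_cop (bvec (T, T'))) =
      (\<Sum>U | admissible U T'. if U = finest_admissible T'
        then bvec (top_quot T U, top_quot T' U) else (0 :: _ \<Rightarrow>\<^sub>0 'k))"
    unfolding Gamma_cop_bvec counit_left_sum_bvec
    by (intro sum.cong refl)
      (auto simp: counit_bvec fin' topspace_admissible admissible_sym_iff[OF fin'])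
  also have "\<dots> = bvec (T, T')"
    using fin fin' adm admissible_refl[OF fin']
    by (simp add: finite_admissible admissible_finest_admissible top_quot_finest_admissible)
  finally show ?thesis .
qed

lemma Gamma_counit_right:
  assumes fin: "finite (topspace T)" and adm: "admissible T' T"
  shows "counit_right counit (Gamma_cop (bvec (T, T'))) = (bvec (T, T') :: _ \<Rightarrow>\<^sub>0 'k::field)"
proof -
  have fin': "finite (topspace T')"
    using fin topspace_admissible[OF adm] by simp
  \<comment> \<open>The counit now tests symmetry of \<open>top_quot T' U\<close>, which singles out
    \<open>U = T'\<close>.\<close>
  have "counit_right counit (Gamma_cop (bvec (T, T'))) =
      (\<Sum>U | admissible U T'. if U = T' then bvec (T, U) else (0 :: _ \<Rightarrow>\<^sub>0 'k))"
    unfolding Gamma_cop_bvec counit_right_sum_bvec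
    by (intro sum.cong refl) (auto simp: counit_bvec fin' top_quot_sym_iff[OF fin'])
  also have "\<dots> = bvec (T, T')"
    using fin' admissible_refl[OF fin'] by (simp add: finite_admissible)
  finally show ?thesis .
qed

lemma Phi_counit_left:
  assumes fin: "finite (topspace T)" and Y: "openin T Y"
  shows "counit_left counit (Phi (bvec (T, Y))) = (bvec (T, Y) :: _ \<Rightarrow>\<^sub>0 'k::field)"
proof -
  have "counit_left counit (Phi (bvec (T, Y))) =
      (\<Sum>U | admissible U T \<and> coact_admissible T Y U. if U = finest_admissible T
        then bvec (top_quot T U, Y) else (0 :: _ \<Rightarrow>\<^sub>0 'k))"
    unfolding Phi_bvec counit_left_sum_bvec
    by (intro sum.cong refl)
      (auto simp: counit_bvec fin topspace_admissible admissible_sym_iff[OF fin])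
  also have "\<dots> = bvec (T, Y)"
    using fin Y admissible_refl[OF fin] finite_admissible[OF fin]
    by (simp add: admissible_finest_admissible coact_admissible_finest top_quot_finest_admissible)
  finally show ?thesis .
qed

section \<open>From basis vectors to the full coalgebra and comodule axioms\<close>

lemma coalgebra_Dt:
  assumes "finite X"
  shows "coalgebra (Dt_basis X)
    (Gamma_cop :: ('a topology \<times> 'a topology \<Rightarrow>\<^sub>0 'k::field) \<Rightarrow> _) counit"
  unfolding coalgebra_def
proof (intro conjI ballI)
  have basis: "(T, T') \<in> Dt_basis X \<longleftrightarrow> topspace T = X \<and> admissible T' T" for T T'
    by (auto simp: Dt_basis_def topspace_admissible)
  show "linear_between fscale fscale (free_space (Dt_basis X)) (free_space (Dt_basis X \<times> Dt_basis X))
      (Gamma_cop :: ('a topology \<times> 'a topology \<Rightarrow>\<^sub>0 'k) \<Rightarrow> _)"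
    unfolding Gamma_cop_def
    by (intro linear_between_lin_ext vector_space_fscale image_subsetI,
        erule lin_ext_in_free_space)
      (use assms in \<open>auto simp: basis tensor_bvec intro!: sum_in_free_space
        intro: admissible_trans admissible_top_quot\<close>)
  show "linear_between fscale (*) (free_space (Dt_basis X)) UNIV
      (counit :: ('a topology \<times> 'a topology \<Rightarrow>\<^sub>0 'k) \<Rightarrow> 'k)"
    unfolding counit_def by (intro linear_between_lin_ext vector_space_mult) simp
next
  fix v :: "'a topology \<times> 'a topology \<Rightarrow>\<^sub>0 'k" assume v: "v \<in> free_space (Dt_basis X)"
  have *: "\<exists>T T'. b = (T, T') \<and> finite (topspace T) \<and> admissible T' T" if "b \<in> Dt_basis X" for b
    using that assms by (auto simp: Dt_basis_def)
  show "tensor_map id Gamma_cop (Gamma_cop v) = tensor_assoc (tensor_map Gamma_cop id (Gamma_cop v))"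
    by (rule linear_eq_on_free_space[OF linear_comp[OF linear_Gamma_cop linear_tensor_map]
          linear_comp[OF linear_comp[OF linear_Gamma_cop linear_tensor_map] linear_tensor_assoc] _ v])
      (use * Gamma_coassoc in blast)
  show "counit_left counit (Gamma_cop v) = v"
    by (rule linear_eq_on_free_space[OF linear_comp[OF linear_Gamma_cop linear_counit_left] linear_ident _ v])
      (use * Gamma_counit_left in blast)
  show "counit_right counit (Gamma_cop v) = v"
    by (rule linear_eq_on_free_space[OF linear_comp[OF linear_Gamma_cop linear_counit_right] linear_ident _ v])
      (use * Gamma_counit_right in blast)
qed

theorem theorem3p1:
  fixes X :: "'a set"
  assumes "finite X"
  shows "left_comodule (Dt_basis X)
           (Gamma_cop :: ('a topology \<times> 'a topology \<Rightarrow>\<^sub>0 'k::field) \<Rightarrow> _) counit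
           (D_basis X) Phi"
  unfolding left_comodule_def
proof (intro conjI ballI)
  show "coalgebra (Dt_basis X)
      (Gamma_cop :: ('a topology \<times> 'a topology \<Rightarrow>\<^sub>0 'k::field) \<Rightarrow> _) counit"
    by (rule coalgebra_Dt[OF assms])
  show "linear_between fscale fscale (free_space (D_basis X)) (free_space (Dt_basis X \<times> D_basis X))
      (Phi :: ('a topology \<times> 'a set \<Rightarrow>\<^sub>0 'k) \<Rightarrow> _)"
    unfolding Phi_def
    by (intro linear_between_lin_ext vector_space_fscale image_subsetI,
        erule lin_ext_in_free_space)
      (auto simp: D_basis_def Dt_basis_def tensor_bvec topspace_admissible intro!: sum_in_free_space)
next
  fix v :: "'a topology \<times> 'a set \<Rightarrow>\<^sub>0 'k" assume v: "v \<in> free_space (D_basis X)"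
  have *: "\<exists>T Y. b = (T, Y) \<and> finite (topspace T) \<and> openin T Y" if "b \<in> D_basis X" for b
    using that assms by (auto simp: D_basis_def)
  show "tensor_map id Phi (Phi v) = tensor_assoc (tensor_map Gamma_cop id (Phi v))"
    by (rule linear_eq_on_free_space[OF linear_comp[OF linear_Phi linear_tensor_map]
          linear_comp[OF linear_comp[OF linear_Phi linear_tensor_map] linear_tensor_assoc] _ v])
      (use * Phi_coassoc in blast)
  show "counit_left counit (Phi v) = v"
    by (rule linear_eq_on_free_space[OF linear_comp[OF linear_Phi linear_counit_left] linear_ident _ v])
      (use * Phi_counit_left in blast)
qed

end
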